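(* The space $X_{2,1}$ is contractible.
   Context: Graphs are finite, undirected and connected; loops and multiple edges are allowed. The genus of $G$ is $|E(G)|-|V(G)|+1$. $\Delta(G)$ is the realization of $G$ as a 1-dimensional CW complex, edges parametrized by $[0,1]$. A graph is stable if it has no bridges and no vertex of valency $2$ unless that vertex is adjacent to a loop. $[n]=\{1,\dots,n\}$. The space $X_{g,n}$ ($g\ge2$, $n\ge0$): let $TM^b_{g,n}$ be the set of isometry classes of triples $(G,l_G,p_G)$ with $G$ a stable graph of genus $g$, $l_G:E(G)\to(0,\infty)$ a length function and $p_G:[n]\to\Delta(G)$ an arbitrary marking function (isometries carry markings to markings). It has the quotient topology from $\coprod_G L(G)\times\Delta(G)^n$, where $L(G)$ is the set of $l:E(G)\to[0,\infty)$ whose zero edges form a forest, and $(l,p)$ is sent to the class of the marked metric graph obtained by contracting all edges of length $0$ (a marked point at relative position $s$ in an edge $e$ of positive length sits at distance $s\,l(e)$ from the corresponding end). $X_{g,n}$ is the subspace of $TM^b_{g,n}$ consisting of points whose representing metric graphs have maximal edge length $1$ and for which the edges of length strictly less than $1$ form a forest (contain no cycles). *)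

theory Defs
  imports "HOL-Analysis.Analysis"
begin

section \<open>Graphs\<close>

text \<open>An undirected multigraph, loops allowed. The ends of an edge are listed as
  \<open>tail\<close> and \<open>head\<close> only in order to parametrize the edge by \<open>[0,1]\<close>; all graph-theoretic
  notions below ignore this orientation.\<close>

record mgraph =
  verts :: "nat set"
  edges :: "nat set"
  tail :: "nat \<Rightarrow> nat"
  head :: "nat \<Rightarrow> nat"

definition joins :: "mgraph \<Rightarrow> nat \<Rightarrow> nat \<Rightarrow> nat \<Rightarrow> bool" where
  "joins G e u v \<longleftrightarrow> tail G e = u \<and> head G e = v \<or> tail G e = v \<and> head G e = u"

definition adj :: "mgraph \<Rightarrow> nat set \<Rightarrow> (nat \<times> nat) set" where
  "adj G F = {(u, v). \<exists>e\<in>F. joins G e u v}"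

definition connects :: "mgraph \<Rightarrow> nat set \<Rightarrow> bool" where
  "connects G F \<longleftrightarrow> (\<forall>u\<in>verts G. \<forall>v\<in>verts G. (u, v) \<in> (adj G F)\<^sup>*)"

definition connected_graph :: "mgraph \<Rightarrow> bool" where
  "connected_graph G \<longleftrightarrow>
     finite (verts G) \<and> verts G \<noteq> {} \<and> finite (edges G) \<and>
     (\<forall>e\<in>edges G. tail G e \<in> verts G \<and> head G e \<in> verts G) \<and>
     connects G (edges G)"

definition genus :: "mgraph \<Rightarrow> int" where
  "genus G = int (card (edges G)) - int (card (verts G)) + 1"

definition bridge :: "mgraph \<Rightarrow> nat \<Rightarrow> bool" where
  "bridge G e \<longleftrightarrow> e \<in> edges G \<and> \<not> connects G (edges G - {e})"

text \<open>A loop contributes 2 to the valency of its vertex.\<close>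

definition valency :: "mgraph \<Rightarrow> nat \<Rightarrow> nat" where
  "valency G v = card {e \<in> edges G. tail G e = v} + card {e \<in> edges G. head G e = v}"

definition stable_graph :: "mgraph \<Rightarrow> bool" where
  "stable_graph G \<longleftrightarrow>
     connected_graph G \<and> (\<forall>e\<in>edges G. \<not> bridge G e) \<and>
     (\<forall>v\<in>verts G. valency G v = 2 \<longrightarrow> (\<exists>e\<in>edges G. tail G e = v \<and> head G e = v))"

text \<open>A cycle of length \<open>k\<close>, given by its vertices and edges in cyclic order; a loop is a
  cycle of length 1 and a pair of parallel edges is one of length 2.\<close>

definition is_cycle :: "mgraph \<Rightarrow> nat list \<Rightarrow> nat list \<Rightarrow> bool" where
  "is_cycle G vs es \<longleftrightarrow>
     es \<noteq> [] \<and> length vs = length es \<and> distinct vs \<and> distinct es \<and>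
     set vs \<subseteq> verts G \<and> set es \<subseteq> edges G \<and>
     (\<forall>i<length es. joins G (es ! i) (vs ! i) (vs ! (Suc i mod length es)))"

definition is_forest :: "mgraph \<Rightarrow> nat set \<Rightarrow> bool" where
  "is_forest G F \<longleftrightarrow> F \<subseteq> edges G \<and> \<not> (\<exists>vs es. is_cycle G vs es \<and> set es \<subseteq> F)"


section \<open>Quotient topologies\<close>

definition quotient_topology :: "'a topology \<Rightarrow> ('a \<Rightarrow> 'b) \<Rightarrow> 'b topology" where
  "quotient_topology X f =
     topology (\<lambda>U. U \<subseteq> f ` topspace X \<and> openin X {x \<in> topspace X. f x \<in> U})"

lemma openin_quotient_topology:
  "openin (quotient_topology X f) U \<longleftrightarrow>
     U \<subseteq> f ` topspace X \<and> openin X {x \<in> topspace X. f x \<in> U}"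
proof -
  have "istopology (\<lambda>U. U \<subseteq> f ` topspace X \<and> openin X {x \<in> topspace X. f x \<in> U})"
    unfolding istopology_def
  proof (intro conjI allI impI)
    fix S T
    assume S: "S \<subseteq> f ` topspace X \<and> openin X {x \<in> topspace X. f x \<in> S}"
      and T: "T \<subseteq> f ` topspace X \<and> openin X {x \<in> topspace X. f x \<in> T}"
    from S show "S \<inter> T \<subseteq> f ` topspace X"
      by blast
    have "openin X ({x \<in> topspace X. f x \<in> S} \<inter> {x \<in> topspace X. f x \<in> T})"
      by (rule openin_Int[OF conjunct2[OF S] conjunct2[OF T]])
    moreover have "{x \<in> topspace X. f x \<in> S} \<inter> {x \<in> topspace X. f x \<in> T} =
        {x \<in> topspace X. f x \<in> S \<inter> T}"
      by blast
    ultimately show "openin X {x \<in> topspace X. f x \<in> S \<inter> T}"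
      by (simp only:)
  next
    fix K
    assume K: "\<forall>S\<in>K. S \<subseteq> f ` topspace X \<and> openin X {x \<in> topspace X. f x \<in> S}"
    then show "\<Union>K \<subseteq> f ` topspace X"
      by blast
    have "openin X (\<Union>((\<lambda>S. {x \<in> topspace X. f x \<in> S}) ` K))"
      by (rule openin_Union) (use K in blast)
    moreover have "\<Union>((\<lambda>S. {x \<in> topspace X. f x \<in> S}) ` K) = {x \<in> topspace X. f x \<in> \<Union>K}"
      by blast
    ultimately show "openin X {x \<in> topspace X. f x \<in> \<Union>K}"
      by (simp only:)
  qed
  then show ?thesis
    by (simp add: quotient_topology_def)
qed

lemma topspace_quotient_topology [simp]:
  "topspace (quotient_topology X f) = f ` topspace X"
proof
  show "topspace (quotient_topology X f) \<subseteq> f ` topspace X"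
    using openin_quotient_topology[THEN iffD1, OF openin_topspace] by (rule conjunct1)
  have "{x \<in> topspace X. f x \<in> f ` topspace X} = topspace X"
    by blast
  then have "openin (quotient_topology X f) (f ` topspace X)"
    by (simp add: openin_quotient_topology)
  then show "f ` topspace X \<subseteq> topspace (quotient_topology X f)"
    by (rule openin_subset)
qed

lemma quotient_map_quotient_topology: "quotient_map X (quotient_topology X f) f"
  unfolding quotient_map_def topspace_quotient_topology openin_quotient_topology by blast


section \<open>The realization of a graph\<close>

text \<open>A pair \<open>(c, s)\<close> is a point of the disjoint union of the vertices \<open>c = Inl v\<close> (with \<open>s = 0\<close>)
  and the closed intervals \<open>c = Inr e\<close>, \<open>0 \<le> s \<le> 1\<close>. A point of the realization is written as its
  normal form in this union: a vertex, or an interior point of an edge.\<close>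

type_synonym point = "(nat + nat) \<times> real"

definition cells :: "mgraph \<Rightarrow> point topology" where
  "cells G = sum_topology (case_sum (\<lambda>v. top_of_set {0}) (\<lambda>e. top_of_set {0..1}))
               (verts G <+> edges G)"

fun glue :: "mgraph \<Rightarrow> point \<Rightarrow> point" where
  "glue G (Inl v, s) = (Inl v, 0)"
| "glue G (Inr e, s) =
     (if s = 0 then (Inl (tail G e), 0) else if s = 1 then (Inl (head G e), 0) else (Inr e, s))"

definition realization :: "mgraph \<Rightarrow> point topology" where
  "realization G = quotient_topology (cells G) (glue G)"

text \<open>The path metric determined by edge lengths \<open>l\<close>: the infimum of the lengths of chains of
  segments, the triple \<open>(e, s, t)\<close> being the segment from \<open>s\<close> to \<open>t\<close> in the closed edge \<open>e\<close>.\<close>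

fun chain :: "mgraph \<Rightarrow> point \<Rightarrow> (nat \<times> real \<times> real) list \<Rightarrow> point \<Rightarrow> bool" where
  "chain G x [] y \<longleftrightarrow> x = y"
| "chain G x ((e, s, t) # cs) y \<longleftrightarrow>
     e \<in> edges G \<and> s \<in> {0..1} \<and> t \<in> {0..1} \<and> x = glue G (Inr e, s) \<and>
     chain G (glue G (Inr e, t)) cs y"

definition chain_length :: "(nat \<Rightarrow> real) \<Rightarrow> (nat \<times> real \<times> real) list \<Rightarrow> real" where
  "chain_length l cs = (\<Sum>(e, s, t)\<leftarrow>cs. l e * \<bar>s - t\<bar>)"

definition path_dist :: "mgraph \<Rightarrow> (nat \<Rightarrow> real) \<Rightarrow> point \<Rightarrow> point \<Rightarrow> real" where
  "path_dist G l x y = Inf {chain_length l cs | cs. chain G x cs y}"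


section \<open>Marked metric graphs\<close>

type_synonym marked_graph = "mgraph \<times> (nat \<Rightarrow> real) \<times> (nat \<Rightarrow> point)"

definition marked_metric_graphs :: "nat \<Rightarrow> nat \<Rightarrow> marked_graph set" where
  "marked_metric_graphs g n =
     {(G, l, p). stable_graph G \<and> genus G = int g \<and>
                 l \<in> edges G \<rightarrow>\<^sub>E {0<..} \<and> p \<in> {1..n} \<rightarrow>\<^sub>E topspace (realization G)}"

definition isometric :: "nat \<Rightarrow> marked_graph \<Rightarrow> marked_graph \<Rightarrow> bool" where
  "isometric n = (\<lambda>(G, l, p) (H, m, q).
     \<exists>\<phi>. bij_betw \<phi> (topspace (realization G)) (topspace (realization H)) \<and>
         (\<forall>x\<in>topspace (realization G). \<forall>y\<in>topspace (realization G).
            path_dist H m (\<phi> x) (\<phi> y) = path_dist G l x y) \<and>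
         (\<forall>i\<in>{1..n}. \<phi> (p i) = q i))"

definition iso_class :: "nat \<Rightarrow> nat \<Rightarrow> marked_graph \<Rightarrow> marked_graph set" where
  "iso_class g n t = {t' \<in> marked_metric_graphs g n. isometric n t t'}"


section \<open>Contraction\<close>

text \<open>Contracting the edges in \<open>F\<close> merges each component of the subgraph with edge set \<open>F\<close>
  into its least vertex.\<close>

definition merged :: "mgraph \<Rightarrow> nat set \<Rightarrow> nat \<Rightarrow> nat" where
  "merged G F v = (LEAST w. (v, w) \<in> (adj G F)\<^sup>*)"

definition contract :: "mgraph \<Rightarrow> nat set \<Rightarrow> mgraph" where
  "contract G F =
     \<lparr>verts = merged G F ` verts G, edges = edges G - F,
      tail = (\<lambda>e. merged G F (tail G e)), head = (\<lambda>e. merged G F (head G e))\<rparr>"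

fun contract_point :: "mgraph \<Rightarrow> nat set \<Rightarrow> point \<Rightarrow> point" where
  "contract_point G F (Inl v, s) = (Inl (merged G F v), s)"
| "contract_point G F (Inr e, s) =
     (if e \<in> F then (Inl (merged G F (tail G e)), 0) else (Inr e, s))"

definition zero_edges :: "mgraph \<Rightarrow> (nat \<Rightarrow> real) \<Rightarrow> nat set" where
  "zero_edges G l = {e \<in> edges G. l e = 0}"

definition contract_marked :: "nat \<Rightarrow> marked_graph \<Rightarrow> marked_graph" where
  "contract_marked n = (\<lambda>(G, l, p).
     let F = zero_edges G l
     in (contract G F, restrict l (edges G - F), \<lambda>i\<in>{1..n}. contract_point G F (p i)))"


section \<open>The moduli spaces\<close>

definition length_space :: "mgraph \<Rightarrow> (nat \<Rightarrow> real) topology" where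
  "length_space G =
     subtopology (product_topology (\<lambda>e. top_of_set {0..}) (edges G))
       {l. is_forest G (zero_edges G l)}"

text \<open>For \<open>g \<ge> 2\<close> contracting a forest preserves stability and the genus, and each marked metric
  graph is the contraction of itself along no edges; so the underlying set of this quotient
  consists of all isometry classes. Summing over all graphs on natural numbers rather than over
  representatives of isomorphism classes gives the same quotient topology.\<close>

definition TM_space :: "nat \<Rightarrow> nat \<Rightarrow> marked_graph set topology" where
  "TM_space g n =
     quotient_topology
       (sum_topology
          (\<lambda>G. prod_topology (length_space G) (product_topology (\<lambda>i. realization G) {1..n}))
          {G. stable_graph G \<and> genus G = int g})
       (\<lambda>t. iso_class g n (contract_marked n t))"

definition X_space :: "nat \<Rightarrow> nat \<Rightarrow> marked_graph set topology" where
  "X_space g n =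
     subtopology (TM_space g n)
       {iso_class g n (G, l, p) | G l p.
          (G, l, p) \<in> marked_metric_graphs g n \<and> Max (l ` edges G) = 1 \<and>
          is_forest G {e \<in> edges G. l e < 1}}"

end

theory Submission
  imports Defs
begin

text \<open>
  A stable graph of genus 2 is a theta graph (three parallel edges) or a rose (one vertex, two
  loops), by counting valencies (\<open>stable_genus_2_cases\<close>). The edges of length less than 1 form a
  forest, so the metric graphs in \<open>X_space 2 1\<close> are the theta graphs with lengths \<open>1, 1, a\<close> for
  \<open>0 < a \<le> 1\<close> and, as the limit \<open>a = 0\<close>, the rose with lengths \<open>1, 1\<close>. By symmetry the marking
  may be put on a fixed edge of length 1 or on the edge of length \<open>a\<close>, at relative
  position \<open>s \<le> 1/2\<close>. So two rectangles of parameters \<open>(a, s)\<close> cover the space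
  (\<open>topspace_X_space\<close>). Sliding the marking along its edge to the nearest vertex, and letting
  \<open>a\<close> go to 1 at the same time, contracts the space.

  This is made precise by a model. Let \<open>b\<close> be the distance from the marking to the nearest vertex.
  The two rectangles are mapped to real 3-space by \<open>(a, b, 0)\<close> and \<open>(a, b, b * (1 - a))\<close>, and this
  makes exactly the identifications that are made in the moduli space (\<open>param_eq_iff\<close>). Since the
  rectangles are compact, the model is homeomorphic to \<open>X_space 2 1\<close> as soon as the latter is
  Hausdorff (\<open>homeomorphic_if_same_fibres\<close>), and in the model the contraction is an explicit
  formula (\<open>contractible_model\<close>).

  Both the Hausdorff property and the fact that no further identifications occur need continuous
  functions on the moduli space that determine the coordinates. For these, suprema of sums of
  distances are used, where one point is the marking and the others range over the graph
  (\<open>spread\<close>). They are isometry invariants for free and do not change under contraction of edges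
  of length 0 (\<open>path_dist_contract\<close>). They are continuous on the moduli space because the path
  distance depends continuously on the edge lengths, uniformly in the points
  (\<open>d_lengths_close\<close>). Three of them suffice: the longest perimeter of a triangle, which is
  the total length \<open>2 + a\<close> (\<open>max_perimeter\<close>), the longest perimeter of a triangle with the marking
  as a corner, and the largest distance from the marking (\<open>coord_eq_if_class_spread_eq\<close>).
\<close>

section \<open>The path pseudometric of a graph with edge lengths\<close>

abbreviation points :: "mgraph \<Rightarrow> point set" where
  "points G \<equiv> topspace (realization G)"

lemma cells_iff:
  "(c, s) \<in> topspace (cells G) \<longleftrightarrow>
     (case c of Inl v \<Rightarrow> v \<in> verts G \<and> s = 0 | Inr e \<Rightarrow> e \<in> edges G \<and> s \<in> {0..1})"
  unfolding cells_def topspace_sum_topology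
  by (cases c)
    (simp_all only: mem_Sigma_iff o_def sum.case topspace_euclidean_subtopology,
      simp_all add: Plus_def image_iff)

lemma points_iff:
  "x \<in> points G \<longleftrightarrow>
     (\<exists>v\<in>verts G. x = (Inl v, 0)) \<or> (\<exists>e\<in>edges G. \<exists>s\<in>{0..1}. x = glue G (Inr e, s))"
    (is "_ \<longleftrightarrow> ?V \<or> ?E")
proof -
  have "x \<in> points G \<longleftrightarrow> (\<exists>c s. (c, s) \<in> topspace (cells G) \<and> x = glue G (c, s))"
    unfolding realization_def topspace_quotient_topology by (auto simp del: glue.simps)
  also have "\<dots> \<longleftrightarrow> ?V \<or> ?E"
    unfolding cells_iff split_sum_ex sum.case glue.simps(1) by blast
  finally show ?thesis .
qed

lemma vertex_in_points: "v \<in> verts G \<Longrightarrow> (Inl v, 0) \<in> points G"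
  by (auto simp: points_iff)

lemma edge_in_points: "e \<in> edges G \<Longrightarrow> s \<in> {0..1} \<Longrightarrow> glue G (Inr e, s) \<in> points G"
  unfolding points_iff by blast

lemma ends_in_verts:
  "connected_graph G \<Longrightarrow> e \<in> edges G \<Longrightarrow> tail G e \<in> verts G \<and> head G e \<in> verts G"
  by (auto simp: connected_graph_def)

lemma chain_append: "chain G x cs y \<Longrightarrow> chain G y ds z \<Longrightarrow> chain G x (cs @ ds) z"
  by (induction cs arbitrary: x) auto

lemma chain_length_simps [simp]:
  "chain_length l [] = 0"
  "chain_length l ((e, s, t) # cs) = l e * \<bar>s - t\<bar> + chain_length l cs"
  "chain_length l (cs @ ds) = chain_length l cs + chain_length l ds"
  by (simp_all add: chain_length_def)

lemma chain_rev:
  assumes "chain G x cs y"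
  shows "\<exists>ds. chain G y ds x \<and> chain_length l ds = chain_length l cs \<and> fst ` set ds = fst ` set cs"
  using assms
proof (induction cs arbitrary: x)
  case Nil
  then show ?case by (intro exI[of _ "[]"]) auto
next
  case (Cons c cs)
  obtain e s t where c: "c = (e, s, t)" by (cases c)
  from Cons.prems c have e: "e \<in> edges G" "s \<in> {0..1}" "t \<in> {0..1}" "x = glue G (Inr e, s)"
    and "chain G (glue G (Inr e, t)) cs y" by auto
  then obtain ds where ds: "chain G y ds (glue G (Inr e, t))" "chain_length l ds = chain_length l cs"
    "fst ` set ds = fst ` set cs"
    using Cons.IH by blast
  have "chain G y (ds @ [(e, t, s)]) x"
    by (rule chain_append[OF ds(1)]) (use e in auto)
  then show ?case
    using ds c by (intro exI[of _ "ds @ [(e, t, s)]"]) (auto simp: abs_minus_commute)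
qed

lemma chain_of_walk:
  assumes "(u, v) \<in> (adj G F)\<^sup>*" "F \<subseteq> edges G"
  shows "\<exists>cs. chain G (Inl u, 0) cs (Inl v, 0) \<and> fst ` set cs \<subseteq> F"
  using assms(1)
proof (induction rule: rtrancl_induct)
  case base
  show ?case by (intro exI[of _ "[]"]) auto
next
  case (step v w)
  then obtain cs where cs: "chain G (Inl u, 0) cs (Inl v, 0)" "fst ` set cs \<subseteq> F" by blast
  from step obtain e where e: "e \<in> F" "joins G e v w" by (auto simp: adj_def)
  then have "chain G (Inl v, 0) [(e, 0, 1)] (Inl w, 0) \<or> chain G (Inl v, 0) [(e, 1, 0)] (Inl w, 0)"
    using assms(2) by (auto simp: joins_def)
  then obtain c where c: "chain G (Inl v, 0) [c] (Inl w, 0)" "fst c = e" by (meson fst_conv)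
  have "fst ` set (cs @ [c]) \<subseteq> F" using cs(2) c(2) e(1) by simp
  then show ?case using chain_append[OF cs(1) c(1)] by blast
qed

text \<open>Lengths are allowed to vanish, so that a contraction does not change the underlying graph;
  what is obtained is then only a pseudometric.\<close>

locale weighted_graph =
  fixes G :: mgraph and l :: "nat \<Rightarrow> real"
  assumes conn: "connected_graph G"
    and nonneg: "e \<in> edges G \<Longrightarrow> 0 \<le> l e"
begin

abbreviation d :: "point \<Rightarrow> point \<Rightarrow> real" where
  "d \<equiv> path_dist G l"

lemma chain_length_nonneg: "chain G x cs y \<Longrightarrow> 0 \<le> chain_length l cs"
proof (induction cs arbitrary: x)
  case (Cons c cs)
  obtain e s t where c: "c = (e, s, t)" by (cases c)
  have "0 \<le> l e" "0 \<le> chain_length l cs"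
    using Cons.prems Cons.IH[of "glue G (Inr e, t)"] unfolding c by (simp_all add: nonneg del: glue.simps)
  then show ?case unfolding c by simp
qed simp

lemma point_cases:
  assumes "x \<in> points G"
  obtains v where "v \<in> verts G" "x = (Inl v, 0)"
  | e s where "e \<in> edges G" "0 < s" "s < 1" "x = (Inr e, s)"
proof -
  consider v where "v \<in> verts G" "x = (Inl v, 0)"
    | e s where "e \<in> edges G" "s \<in> {0..1}" "x = glue G (Inr e, s)"
    using assms unfolding points_iff by blast
  then show thesis
  proof cases
    case 2
    show thesis
    proof (cases "s = 0 \<or> s = 1")
      case True
      then have "x = (Inl (tail G e), 0) \<or> x = (Inl (head G e), 0)" using 2 by auto
      then show thesis using ends_in_verts[OF conn 2(1)] that(1) by blast
    next
      case False
      then show thesis using 2 that(2)[of e s] by auto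
    qed
  qed (use that in blast)
qed

lemma chain_to_vertex:
  assumes "x \<in> points G"
  obtains v cs where "v \<in> verts G" "chain G x cs (Inl v, 0)"
  using assms
proof (cases rule: point_cases)
  case (1 v)
  then show thesis using that[of v "[]"] by auto
next
  case (2 e s)
  then have "chain G x [(e, s, 0)] (Inl (tail G e), 0)" by auto
  then show thesis using that ends_in_verts[OF conn 2(1)] by blast
qed

lemma chain_exists:
  assumes "x \<in> points G" "y \<in> points G"
  obtains cs where "chain G x cs y"
proof -
  obtain u cs where u: "u \<in> verts G" "chain G x cs (Inl u, 0)"
    using chain_to_vertex assms(1) by blast
  obtain v ds where v: "v \<in> verts G" "chain G y ds (Inl v, 0)"
    using chain_to_vertex assms(2) by blast
  obtain ds' where "chain G (Inl v, 0) ds' y" using chain_rev[OF v(2)] by blast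
  moreover obtain es where "chain G (Inl u, 0) es (Inl v, 0)"
    using chain_of_walk[of u v G "edges G"] conn u v
    by (auto simp: connected_graph_def connects_def)
  ultimately show thesis using that u(2) by (meson chain_append)
qed

lemma lengths_bdd_below: "bdd_below {chain_length l cs | cs. chain G x cs y}"
  by (rule bdd_belowI[of _ 0]) (use chain_length_nonneg in blast)

lemma d_le: "chain G x cs y \<Longrightarrow> d x y \<le> chain_length l cs"
  unfolding path_dist_def by (rule cInf_lower[OF _ lengths_bdd_below]) auto

lemma d_ge:
  assumes "x \<in> points G" "y \<in> points G" "\<And>cs. chain G x cs y \<Longrightarrow> r \<le> chain_length l cs"
  shows "r \<le> d x y"
  unfolding path_dist_def using chain_exists[OF assms(1,2)] assms(3)
  by (intro cInf_greatest) auto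

lemma d_nonneg: "x \<in> points G \<Longrightarrow> y \<in> points G \<Longrightarrow> 0 \<le> d x y"
  by (rule d_ge) (assumption | rule chain_length_nonneg)+

lemma d_approx:
  assumes "x \<in> points G" "y \<in> points G" "0 < \<epsilon>"
  obtains cs where "chain G x cs y" "chain_length l cs < d x y + \<epsilon>"
proof -
  have "\<exists>cs. chain G x cs y \<and> chain_length l cs < d x y + \<epsilon>"
  proof (rule ccontr)
    assume "\<not> ?thesis"
    then have "d x y + \<epsilon> \<le> d x y" by (intro d_ge[OF assms(1,2)]) (auto simp: not_less)
    then show False using assms(3) by simp
  qed
  then show thesis using that by blast
qed

lemma d_refl: "x \<in> points G \<Longrightarrow> d x x = 0"
  using d_le[of x "[]" x] d_nonneg[of x x] by auto

lemma d_sym_le: "x \<in> points G \<Longrightarrow> y \<in> points G \<Longrightarrow> d x y \<le> d y x"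
  by (rule d_ge) (use chain_rev[where l = l] d_le in metis)+

lemma d_sym: "x \<in> points G \<Longrightarrow> y \<in> points G \<Longrightarrow> d x y = d y x"
  by (intro antisym d_sym_le)

lemma d_triangle:
  assumes "x \<in> points G" "y \<in> points G" "z \<in> points G"
  shows "d x z \<le> d x y + d y z"
proof (rule field_le_epsilon)
  fix \<epsilon> :: real assume "0 < \<epsilon>"
  then have "0 < \<epsilon> / 2" by simp
  obtain cs where cs: "chain G x cs y" "chain_length l cs < d x y + \<epsilon> / 2"
    using d_approx[OF assms(1,2) \<open>0 < \<epsilon> / 2\<close>] .
  obtain ds where ds: "chain G y ds z" "chain_length l ds < d y z + \<epsilon> / 2"
    using d_approx[OF assms(2,3) \<open>0 < \<epsilon> / 2\<close>] .
  have "d x z \<le> chain_length l (cs @ ds)"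
    by (rule d_le) (rule chain_append[OF cs(1) ds(1)])
  with cs ds show "d x z \<le> d x y + d y z + \<epsilon>" by simp
qed

lemma d_edge:
  "e \<in> edges G \<Longrightarrow> s \<in> {0..1} \<Longrightarrow> t \<in> {0..1} \<Longrightarrow>
    d (glue G (Inr e, s)) (glue G (Inr e, t)) \<le> l e * \<bar>s - t\<bar>"
  using d_le[of "glue G (Inr e, s)" "[(e, s, t)]" "glue G (Inr e, t)"] by (simp del: glue.simps)

text \<open>A function on the realization that does not stretch any edge bounds the distance from
  below. All lower bounds for concrete distances are obtained in this way.\<close>

lemma d_ge_nonexpansive:
  assumes "x \<in> points G" "y \<in> points G"
    and h: "\<And>e s t. e \<in> edges G \<Longrightarrow> s \<in> {0..1} \<Longrightarrow> t \<in> {0..1} \<Longrightarrow>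
      h (glue G (Inr e, t)) - h (glue G (Inr e, s)) \<le> l e * \<bar>s - t\<bar>"
  shows "h y - h x \<le> d x y"
proof (rule d_ge[OF assms(1,2)])
  show "chain G x cs y \<Longrightarrow> h y - h x \<le> chain_length l cs" for cs
  proof (induction cs arbitrary: x)
    case (Cons c cs)
    obtain e s t where c: "c = (e, s, t)" by (cases c)
    show ?case
      using Cons.prems Cons.IH[of "glue G (Inr e, t)"] h[of e s t] unfolding c
      by (simp del: glue.simps)
  qed simp
qed

text \<open>Each point lies on an edge next to a vertex, and there are finitely many of each.\<close>

lemma d_bounded: "\<exists>B. \<forall>x\<in>points G. \<forall>y\<in>points G. d x y \<le> B"
proof -
  have fin: "finite (edges G)" "finite (verts G)" "verts G \<noteq> {}"
    using conn by (auto simp: connected_graph_def)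
  obtain v0 where v0: "v0 \<in> verts G" using fin by blast
  define W where "W = (\<Sum>v\<in>verts G. d (Inl v, 0) (Inl v0, 0))"
  define L where "L = (\<Sum>e\<in>edges G. l e)"
  have W: "d (Inl v, 0) (Inl v0, 0) \<le> W" if "v \<in> verts G" for v
    unfolding W_def using that fin v0
    by (intro member_le_sum) (auto intro!: d_nonneg vertex_in_points)
  have L: "l e \<le> L" if "e \<in> edges G" for e
    unfolding L_def using that fin nonneg by (intro member_le_sum) auto
  have L0: "0 \<le> L" unfolding L_def by (rule sum_nonneg) (rule nonneg)
  have *: "d x (Inl v0, 0) \<le> L + W" if x: "x \<in> points G" for x
    using x
  proof (cases rule: point_cases)
    case (1 v)
    then show ?thesis using W[of v] L0 by simp
  next
    case (2 e s)
    have v: "tail G e \<in> verts G" using ends_in_verts[OF conn 2(1)] by simp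
    have "d x (Inl v0, 0) \<le> d x (Inl (tail G e), 0) + d (Inl (tail G e), 0) (Inl v0, 0)"
      by (intro d_triangle x vertex_in_points v v0)
    moreover have "d x (Inl (tail G e), 0) \<le> l e * \<bar>s - 0\<bar>"
      using d_edge[of e s 0] 2 by simp
    moreover have "l e * \<bar>s - 0\<bar> \<le> l e * 1"
      using 2 nonneg[of e] by (intro mult_left_mono) auto
    ultimately show ?thesis using W[OF v] L[OF 2(1)] by simp
  qed
  have "d x y \<le> (L + W) + (L + W)" if "x \<in> points G" "y \<in> points G" for x y
    using d_triangle[OF that(1) vertex_in_points[OF v0] that(2)] *[OF that(1)] *[OF that(2)]
      d_sym[OF that(2) vertex_in_points[OF v0]] by linarith
  then show ?thesis by blast
qed

end

section \<open>Maps between realizations\<close>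

lemma nonexpansive_on_edges:
  assumes "weighted_graph G l" "weighted_graph H m" "\<phi> ` points G \<subseteq> points H"
    and "\<And>e s t. e \<in> edges G \<Longrightarrow> s \<in> {0..1} \<Longrightarrow> t \<in> {0..1} \<Longrightarrow>
      path_dist H m (\<phi> (glue G (Inr e, s))) (\<phi> (glue G (Inr e, t))) \<le> l e * \<bar>s - t\<bar>"
    and "x \<in> points G" "y \<in> points G"
  shows "path_dist H m (\<phi> x) (\<phi> y) \<le> path_dist G l x y"
proof -
  interpret G: weighted_graph G l by fact
  interpret H: weighted_graph H m by fact
  have pts: "\<phi> z \<in> points H" if "z \<in> points G" for z using assms(3) that by blast
  have "H.d (\<phi> x) (\<phi> y) - H.d (\<phi> x) (\<phi> x) \<le> G.d x y"
  proof (rule G.d_ge_nonexpansive)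
    fix e s t assume e: "e \<in> edges G" "s \<in> {0..1::real}" "t \<in> {0..1::real}"
    note in_G = edge_in_points[OF e(1,2)] edge_in_points[OF e(1,3)]
    show "H.d (\<phi> x) (\<phi> (glue G (Inr e, t))) - H.d (\<phi> x) (\<phi> (glue G (Inr e, s))) \<le> l e * \<bar>s - t\<bar>"
      using H.d_triangle[OF pts[OF assms(5)] pts[OF in_G(1)] pts[OF in_G(2)]] assms(4)[OF e]
      by linarith
  qed (use assms in auto)
  then show ?thesis using H.d_refl[OF pts[OF assms(5)]] by simp
qed

text \<open>Two nonexpansive maps, one of which inverts the other up to points at distance 0, preserve
  distances. This is used both for relabellings and for contractions.\<close>

lemma d_eq_if_nonexpansive_inverse:
  assumes "weighted_graph G l" "weighted_graph H m" "\<phi> ` points G \<subseteq> points H" "\<psi> ` points H \<subseteq> points G"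
    and \<phi>: "\<And>e s t. e \<in> edges G \<Longrightarrow> s \<in> {0..1} \<Longrightarrow> t \<in> {0..1} \<Longrightarrow>
      path_dist H m (\<phi> (glue G (Inr e, s))) (\<phi> (glue G (Inr e, t))) \<le> l e * \<bar>s - t\<bar>"
    and \<psi>: "\<And>e s t. e \<in> edges H \<Longrightarrow> s \<in> {0..1} \<Longrightarrow> t \<in> {0..1} \<Longrightarrow>
      path_dist G l (\<psi> (glue H (Inr e, s))) (\<psi> (glue H (Inr e, t))) \<le> m e * \<bar>s - t\<bar>"
    and inv: "\<And>x. x \<in> points G \<Longrightarrow> path_dist G l x (\<psi> (\<phi> x)) = 0"
    and xy: "x \<in> points G" "y \<in> points G"
  shows "path_dist H m (\<phi> x) (\<phi> y) = path_dist G l x y"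
proof (rule antisym)
  interpret G: weighted_graph G l by fact
  show "path_dist H m (\<phi> x) (\<phi> y) \<le> path_dist G l x y"
    by (rule nonexpansive_on_edges) (use assms in auto)
  have in_H: "\<phi> x \<in> points H" "\<phi> y \<in> points H" using xy assms(3) by auto
  then have in_G: "\<psi> (\<phi> x) \<in> points G" "\<psi> (\<phi> y) \<in> points G" using assms(4) by auto
  have "G.d (\<psi> (\<phi> x)) (\<psi> (\<phi> y)) \<le> path_dist H m (\<phi> x) (\<phi> y)"
    by (rule nonexpansive_on_edges[OF assms(2,1,4) \<psi> in_H])
  moreover have "G.d x y \<le> G.d x (\<psi> (\<phi> x)) + G.d (\<psi> (\<phi> x)) y"
    by (rule G.d_triangle[OF xy(1) in_G(1) xy(2)])
  moreover have "G.d (\<psi> (\<phi> x)) y \<le> G.d (\<psi> (\<phi> x)) (\<psi> (\<phi> y)) + G.d (\<psi> (\<phi> y)) y"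
    by (rule G.d_triangle[OF in_G xy(2)])
  moreover have "G.d (\<psi> (\<phi> y)) y = G.d y (\<psi> (\<phi> y))" by (rule G.d_sym[OF in_G(2) xy(2)])
  ultimately show "G.d x y \<le> path_dist H m (\<phi> x) (\<phi> y)"
    using inv[OF xy(1)] inv[OF xy(2)] by linarith
qed

text \<open>The orientation of an edge only serves to parametrize it, so an isomorphism of graphs may
  reverse edges; these are the ones marked by \<open>flip\<close>.\<close>

fun relabel :: "(nat \<Rightarrow> nat) \<Rightarrow> (nat \<Rightarrow> nat) \<Rightarrow> (nat \<Rightarrow> bool) \<Rightarrow> point \<Rightarrow> point" where
  "relabel \<tau> \<sigma> flip (Inl v, s) = (Inl (\<tau> v), s)"
| "relabel \<tau> \<sigma> flip (Inr e, s) = (Inr (\<sigma> e), if flip e then 1 - s else s)"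

definition relabels ::
    "(nat \<Rightarrow> nat) \<Rightarrow> (nat \<Rightarrow> nat) \<Rightarrow> (nat \<Rightarrow> bool) \<Rightarrow> mgraph \<Rightarrow> (nat \<Rightarrow> real) \<Rightarrow> mgraph \<Rightarrow> (nat \<Rightarrow> real) \<Rightarrow> bool"
  where "relabels \<tau> \<sigma> flip G l H m \<longleftrightarrow>
    bij_betw \<tau> (verts G) (verts H) \<and> bij_betw \<sigma> (edges G) (edges H) \<and>
    (\<forall>e\<in>edges G. m (\<sigma> e) = l e \<and>
      (if flip e then tail H (\<sigma> e) = \<tau> (head G e) \<and> head H (\<sigma> e) = \<tau> (tail G e)
       else tail H (\<sigma> e) = \<tau> (tail G e) \<and> head H (\<sigma> e) = \<tau> (head G e)))"

lemma relabel_glue: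
  assumes "relabels \<tau> \<sigma> flip G l H m" "e \<in> edges G"
  shows "relabel \<tau> \<sigma> flip (glue G (Inr e, s)) = glue H (Inr (\<sigma> e), if flip e then 1 - s else s)"
proof -
  have "if flip e then tail H (\<sigma> e) = \<tau> (head G e) \<and> head H (\<sigma> e) = \<tau> (tail G e)
       else tail H (\<sigma> e) = \<tau> (tail G e) \<and> head H (\<sigma> e) = \<tau> (head G e)"
    using assms unfolding relabels_def by blast
  then show ?thesis by (cases "flip e") auto
qed

lemma relabel_points:
  assumes "relabels \<tau> \<sigma> flip G l H m"
  shows "relabel \<tau> \<sigma> flip ` points G \<subseteq> points H"
proof
  fix y assume "y \<in> relabel \<tau> \<sigma> flip ` points G"
  then obtain x where x: "x \<in> points G" "y = relabel \<tau> \<sigma> flip x" by blast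
  have \<tau>: "\<tau> v \<in> verts H" if "v \<in> verts G" for v
    using assms that unfolding relabels_def by (blast dest: bij_betwE)
  have \<sigma>: "\<sigma> e \<in> edges H" if "e \<in> edges G" for e
    using assms that unfolding relabels_def by (blast dest: bij_betwE)
  from x(1) consider v where "v \<in> verts G" "x = (Inl v, 0)"
    | e s where "e \<in> edges G" "s \<in> {0..1}" "x = glue G (Inr e, s)"
    unfolding points_iff by blast
  then show "y \<in> points H"
  proof cases
    case 1
    then show ?thesis using x(2) \<tau> vertex_in_points by auto
  next
    case 2
    show ?thesis unfolding x(2) 2(3) relabel_glue[OF assms 2(1)]
      by (rule edge_in_points) (use 2 \<sigma> in auto)
  qed
qed

lemma relabels_inverse:
  assumes "relabels \<tau> \<sigma> flip G l H m" "connected_graph G"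
  defines "\<tau>' \<equiv> inv_into (verts G) \<tau>" and "\<sigma>' \<equiv> inv_into (edges G) \<sigma>"
  shows "relabels \<tau>' \<sigma>' (flip \<circ> \<sigma>') H m G l"
    and "x \<in> points G \<Longrightarrow> relabel \<tau>' \<sigma>' (flip \<circ> \<sigma>') (relabel \<tau> \<sigma> flip x) = x"
proof -
  have bij: "bij_betw \<tau> (verts G) (verts H)" "bij_betw \<sigma> (edges G) (edges H)"
    and ends: "\<And>e. e \<in> edges G \<Longrightarrow> m (\<sigma> e) = l e \<and>
      (if flip e then tail H (\<sigma> e) = \<tau> (head G e) \<and> head H (\<sigma> e) = \<tau> (tail G e)
       else tail H (\<sigma> e) = \<tau> (tail G e) \<and> head H (\<sigma> e) = \<tau> (head G e))"
    using assms(1) unfolding relabels_def by blast+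
  have \<tau>': "\<tau>' (\<tau> v) = v" if "v \<in> verts G" for v
    unfolding \<tau>'_def using bij(1) that by (simp add: bij_betw_inv_into_left)
  have \<sigma>': "\<sigma>' (\<sigma> e) = e" if "e \<in> edges G" for e
    unfolding \<sigma>'_def using bij(2) that by (simp add: bij_betw_inv_into_left)
  show "relabels \<tau>' \<sigma>' (flip \<circ> \<sigma>') H m G l"
    unfolding relabels_def
  proof (intro conjI ballI)
    show "bij_betw \<tau>' (verts H) (verts G)" "bij_betw \<sigma>' (edges H) (edges G)"
      unfolding \<tau>'_def \<sigma>'_def by (rule bij_betw_inv_into[OF bij(1)], rule bij_betw_inv_into[OF bij(2)])
  next
    fix e assume "e \<in> edges H"
    then obtain f where f: "f \<in> edges G" "e = \<sigma> f" using bij(2) by (auto simp: bij_betw_def)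
    show "l (\<sigma>' e) = m e" using f ends \<sigma>' by auto
    show "if (flip \<circ> \<sigma>') e then tail G (\<sigma>' e) = \<tau>' (head H e) \<and> head G (\<sigma>' e) = \<tau>' (tail H e)
       else tail G (\<sigma>' e) = \<tau>' (tail H e) \<and> head G (\<sigma>' e) = \<tau>' (head H e)"
      using ends[OF f(1)] \<tau>' ends_in_verts[OF assms(2) f(1)] f \<sigma>'[OF f(1)]
      by (cases "flip f") auto
  qed
  show "relabel \<tau>' \<sigma>' (flip \<circ> \<sigma>') (relabel \<tau> \<sigma> flip x) = x" if x: "x \<in> points G"
  proof -
    have "weighted_graph G (\<lambda>_. 0)" by standard (use assms in auto)
    then show ?thesis
      by (rule weighted_graph.point_cases[OF _ x]) (use \<tau>' \<sigma>' in auto)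
  qed
qed

lemma relabel_nonexpansive:
  assumes "relabels \<tau> \<sigma> flip G l H m" "weighted_graph H m" "e \<in> edges G" "s \<in> {0..1}" "t \<in> {0..1}"
  shows "path_dist H m (relabel \<tau> \<sigma> flip (glue G (Inr e, s))) (relabel \<tau> \<sigma> flip (glue G (Inr e, t)))
    \<le> l e * \<bar>s - t\<bar>"
proof -
  have "\<sigma> e \<in> edges H" "m (\<sigma> e) = l e"
    using assms(1,3) unfolding relabels_def by (blast dest: bij_betwE)+
  then show ?thesis
    using weighted_graph.d_edge[OF assms(2), of "\<sigma> e" "if flip e then 1 - s else s" "if flip e then 1 - t else t"]
      assms(4,5)
    by (auto simp: relabel_glue[OF assms(1,3)] abs_minus_commute simp del: glue.simps split: if_splits)
qed

lemma isometric_if_relabels: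
  assumes r: "relabels \<tau> \<sigma> flip G l H m" and G: "weighted_graph G l" and H: "weighted_graph H m"
    and p: "\<And>i. i \<in> {1..n} \<Longrightarrow> q i = relabel \<tau> \<sigma> flip (p i)"
  shows "isometric n (G, l, p) (H, m, q)"
proof -
  define \<phi> where "\<phi> = relabel \<tau> \<sigma> flip"
  define \<tau>' \<sigma>' where "\<tau>' = inv_into (verts G) \<tau>" and "\<sigma>' = inv_into (edges G) \<sigma>"
  define \<psi> where "\<psi> = relabel \<tau>' \<sigma>' (flip \<circ> \<sigma>')"
  have connG: "connected_graph G" and connH: "connected_graph H"
    using G H by (auto simp: weighted_graph_def)
  have r': "relabels \<tau>' \<sigma>' (flip \<circ> \<sigma>') H m G l"
    unfolding \<tau>'_def \<sigma>'_def by (rule relabels_inverse[OF r connG])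
  have \<psi>\<phi>: "\<psi> (\<phi> x) = x" if "x \<in> points G" for x
    using relabels_inverse(2)[OF r connG that] by (simp add: \<psi>_def \<phi>_def \<tau>'_def \<sigma>'_def)
  have im: "\<phi> ` points G \<subseteq> points H" "\<psi> ` points H \<subseteq> points G"
    unfolding \<phi>_def \<psi>_def by (rule relabel_points[OF r], rule relabel_points[OF r'])
  have dist: "path_dist H m (\<phi> x) (\<phi> y) = path_dist G l x y" if "x \<in> points G" "y \<in> points G" for x y
  proof (rule d_eq_if_nonexpansive_inverse[OF G H im _ _ _ that])
    show "path_dist G l x (\<psi> (\<phi> x)) = 0" if "x \<in> points G" for x
      using that by (simp add: \<psi>\<phi> weighted_graph.d_refl[OF G])
  qed (unfold \<phi>_def \<psi>_def, (rule relabel_nonexpansive[OF r H] relabel_nonexpansive[OF r' G]; assumption)+)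
  have surj: "y \<in> \<phi> ` points G" if "y \<in> points H" for y
  proof -
    show ?thesis
    proof (cases rule: weighted_graph.point_cases[OF H that])
      case (1 v)
      then obtain u where "u \<in> verts G" "v = \<tau> u"
        using r unfolding relabels_def bij_betw_def by blast
      then show ?thesis
        using 1 by (intro image_eqI[of _ _ "(Inl u, 0)"]) (simp_all add: \<phi>_def vertex_in_points)
    next
      case (2 e s)
      then obtain f where f: "f \<in> edges G" "e = \<sigma> f"
        using r unfolding relabels_def bij_betw_def by blast
      have "y = \<phi> (glue G (Inr f, if flip f then 1 - s else s))"
        unfolding \<phi>_def relabel_glue[OF r f(1)] using 2 f(2) by simp
      then show ?thesis using 2 f(1) by (intro image_eqI) (auto intro!: edge_in_points simp del: glue.simps)
    qed
  qed
  have "bij_betw \<phi> (points G) (points H)"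
    unfolding bij_betw_def using im(1) surj by (auto intro!: inj_on_inverseI[of _ \<psi>] \<psi>\<phi>)
  then show ?thesis
    unfolding isometric_def using dist p by (auto simp: \<phi>_def intro!: exI[of _ \<phi>])
qed

section \<open>Contraction of edges of length 0\<close>

lemma sym_adj: "sym (adj G F)"
  by (auto simp: sym_def adj_def joins_def)

lemma merged_reachable: "(v, merged G F v) \<in> (adj G F)\<^sup>*"
  unfolding merged_def by (rule LeastI[of _ v]) simp

lemma merged_eq_iff: "merged G F v = merged G F w \<longleftrightarrow> (v, w) \<in> (adj G F)\<^sup>*"
proof
  assume "merged G F v = merged G F w"
  then show "(v, w) \<in> (adj G F)\<^sup>*"
    using merged_reachable[of v G F] merged_reachable[of w G F] sym_rtrancl[OF sym_adj]
    by (metis rtrancl_trans symD)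
next
  assume "(v, w) \<in> (adj G F)\<^sup>*"
  then have "(v, u) \<in> (adj G F)\<^sup>* \<longleftrightarrow> (w, u) \<in> (adj G F)\<^sup>*" for u
    using sym_rtrancl[OF sym_adj] by (metis rtrancl_trans symD)
  then show "merged G F v = merged G F w" by (simp add: merged_def)
qed

lemma merged_ends: "e \<in> F \<Longrightarrow> merged G F (head G e) = merged G F (tail G e)"
  unfolding merged_eq_iff by (rule r_into_rtrancl) (auto simp: adj_def joins_def)

lemma contract_glue:
  "contract_point G F (glue G (Inr e, s)) =
     (if e \<in> F then (Inl (merged G F (tail G e)), 0) else glue (contract G F) (Inr e, s))"
  by (auto simp: contract_def merged_ends)

lemma connected_contract:
  assumes G: "connected_graph G" and F: "F \<subseteq> edges G"
  shows "connected_graph (contract G F)"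
proof -
  have "(merged G F u, merged G F v) \<in> (adj (contract G F) (edges G - F))\<^sup>*"
    if "(u, v) \<in> (adj G (edges G))\<^sup>*" for u v
    using that
  proof (induction rule: rtrancl_induct)
    case (step v w)
    then obtain e where e: "e \<in> edges G" "joins G e v w" by (auto simp: adj_def)
    show ?case
    proof (cases "e \<in> F")
      case True
      then have "merged G F v = merged G F w" using e merged_ends[of e F G] by (auto simp: joins_def)
      then show ?thesis using step.IH by simp
    next
      case False
      then have "(merged G F v, merged G F w) \<in> adj (contract G F) (edges G - F)"
        using e by (auto simp: adj_def joins_def contract_def)
      then show ?thesis using step.IH by simp
    qed
  qed simp
  then show ?thesis
    using assms unfolding connected_graph_def connects_def by (auto simp: contract_def)
qed

lemma contract_points:
  assumes "connected_graph G"
  shows "contract_point G F ` points G = points (contract G F)"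
proof
  have v: "(Inl (merged G F v), 0) \<in> points (contract G F)" if "v \<in> verts G" for v
    using that by (intro vertex_in_points) (auto simp: contract_def)
  show "contract_point G F ` points G \<subseteq> points (contract G F)"
  proof
    fix y assume "y \<in> contract_point G F ` points G"
    then obtain x where x: "x \<in> points G" "y = contract_point G F x" by blast
    from x(1) consider v where "v \<in> verts G" "x = (Inl v, 0)"
      | e s where "e \<in> edges G" "s \<in> {0..1}" "x = glue G (Inr e, s)"
      unfolding points_iff by blast
    then show "y \<in> points (contract G F)"
    proof cases
      case 1
      then show ?thesis using x v by simp
    next
      case 2
      have "e \<notin> F \<Longrightarrow> e \<in> edges (contract G F)" using 2 by (simp add: contract_def)
      then show ?thesis
        unfolding x 2 contract_glue using v ends_in_verts[OF assms 2(1)] edge_in_points 2(2) by auto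
    qed
  qed
next
  show "points (contract G F) \<subseteq> contract_point G F ` points G"
  proof
    fix y assume y: "y \<in> points (contract G F)"
    then consider v where "v \<in> verts (contract G F)" "y = (Inl v, 0)"
      | e s where "e \<in> edges (contract G F)" "s \<in> {0..1}" "y = glue (contract G F) (Inr e, s)"
      unfolding points_iff by blast
    then show "y \<in> contract_point G F ` points G"
    proof cases
      case 1
      then obtain u where "u \<in> verts G" "v = merged G F u" by (auto simp: contract_def)
      then show ?thesis using 1 by (intro image_eqI[of _ _ "(Inl u, 0)"]) (auto intro: vertex_in_points)
    next
      case 2
      then have e: "e \<in> edges G" "e \<notin> F" by (auto simp: contract_def)
      show ?thesis
        using contract_glue[of G F e s] e 2 by (metis edge_in_points imageI)
    qed
  qed
qed

context weighted_graph
begin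

text \<open>Points with the same image are joined by a chain in the contracted subgraph.\<close>

lemma contract_point_eq_imp_d_0:
  assumes F: "F \<subseteq> edges G" "\<And>e. e \<in> F \<Longrightarrow> l e = 0"
    and xy: "x \<in> points G" "y \<in> points G" "contract_point G F x = contract_point G F y"
  shows "d x y = 0"
proof -
  have vertex: "(\<exists>v\<in>verts G. d z (Inl v, 0) = 0 \<and> contract_point G F z = (Inl (merged G F v), 0)) \<or>
      (\<exists>e s. z = (Inr e, s) \<and> contract_point G F z = z)" if z: "z \<in> points G" for z
    using z
  proof (cases rule: point_cases)
    case (1 v)
    then show ?thesis using d_refl[OF z] by auto
  next
    case (2 e s)
    show ?thesis
    proof (cases "e \<in> F")
      case True
      have "d z (Inl (tail G e), 0) \<le> 0"
        using d_edge[of e s 0] 2 F(2)[OF True] by auto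
      then have "d z (Inl (tail G e), 0) = 0"
        using d_nonneg[OF z vertex_in_points] ends_in_verts[OF conn 2(1)] by (intro antisym) auto
      then show ?thesis using 2 True ends_in_verts[OF conn 2(1)] by auto
    qed (use 2 in auto)
  qed
  show ?thesis
  proof (cases "x = y")
    case True
    then show ?thesis using d_refl xy by simp
  next
    case False
    then obtain v w where v: "v \<in> verts G" "d x (Inl v, 0) = 0" and w: "w \<in> verts G" "d y (Inl w, 0) = 0"
      and vw: "merged G F v = merged G F w"
      using vertex[OF xy(1)] vertex[OF xy(2)] xy(3) by auto
    from vw obtain cs where cs: "chain G (Inl v, 0) cs (Inl w, 0)" "fst ` set cs \<subseteq> F"
      using chain_of_walk[OF _ F(1)] unfolding merged_eq_iff by blast
    have "chain_length l cs = 0"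
      using cs(2) F(2) by (induction cs) auto
    with d_le[OF cs(1)] have "d (Inl v, 0) (Inl w, 0) \<le> 0" by simp
    moreover have "d x y \<le> d x (Inl v, 0) + d (Inl v, 0) y"
      by (intro d_triangle xy vertex_in_points v)
    moreover have "d (Inl v, 0) y \<le> d (Inl v, 0) (Inl w, 0) + d (Inl w, 0) y"
      by (intro d_triangle xy vertex_in_points v w)
    moreover have "d (Inl w, 0) y = d y (Inl w, 0)"
      by (intro d_sym xy vertex_in_points w)
    ultimately show ?thesis using v w d_nonneg[OF xy(1,2)] by linarith
  qed
qed

text \<open>The contraction is nonexpansive, and any choice of preimages is an inverse of it up to points at
  distance 0; it is nonexpansive too because each remaining edge is a preimage of itself.\<close>

lemma path_dist_contract:
  assumes F: "F \<subseteq> edges G" "\<And>e. e \<in> F \<Longrightarrow> l e = 0" and m: "\<And>e. e \<in> edges G - F \<Longrightarrow> m e = l e"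
    and xy: "x \<in> points G" "y \<in> points G"
  shows "path_dist (contract G F) m (contract_point G F x) (contract_point G F y) = d x y"
proof -
  define \<psi> where "\<psi> = inv_into (points G) (contract_point G F)"
  note surj = contract_points[OF conn, of F]
  have H: "weighted_graph (contract G F) m"
    by standard (use connected_contract[OF conn F(1)] m nonneg in \<open>auto simp: contract_def\<close>)
  have \<psi>: "\<psi> z \<in> points G" "contract_point G F (\<psi> z) = z" if "z \<in> points (contract G F)" for z
    unfolding \<psi>_def using that surj by (auto intro: inv_into_into f_inv_into_f)
  have near: "d z (\<psi> (contract_point G F z)) = 0" if "z \<in> points G" for z
  proof -
    have z: "contract_point G F z \<in> points (contract G F)" using that surj by blast
    show ?thesis
      by (rule contract_point_eq_imp_d_0[OF F that \<psi>(1)[OF z] \<psi>(2)[OF z, symmetric]])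
  qed
  have G: "weighted_graph G l" by (rule weighted_graph_axioms)
  have "\<psi> ` points (contract G F) \<subseteq> points G" using \<psi> by blast
  then show ?thesis
  proof (rule d_eq_if_nonexpansive_inverse[OF G H equalityD1[OF surj] _ _ _ near xy])
    fix e s t assume e: "e \<in> edges G" "s \<in> {0..1::real}" "t \<in> {0..1::real}"
    show "path_dist (contract G F) m (contract_point G F (glue G (Inr e, s)))
        (contract_point G F (glue G (Inr e, t))) \<le> l e * \<bar>s - t\<bar>"
    proof (cases "e \<in> F")
      case True
      then show ?thesis
        using ends_in_verts[OF conn e(1)] F(2)
        by (simp add: contract_glue del: glue.simps)
          (intro eq_refl weighted_graph.d_refl[OF H] vertex_in_points, simp add: contract_def)
    next
      case False
      then show ?thesis
        using weighted_graph.d_edge[OF H, of e s t] e m[of e]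
        by (simp add: contract_glue del: glue.simps) (simp add: contract_def)
    qed
  next
    fix e s t assume e: "e \<in> edges (contract G F)" "s \<in> {0..1::real}" "t \<in> {0..1::real}"
    then have eG: "e \<in> edges G" "e \<notin> F" by (auto simp: contract_def)
    have pts: "glue G (Inr e, r) \<in> points G" "glue (contract G F) (Inr e, r) \<in> points (contract G F)"
      if "r \<in> {0..1}" for r
      using that e(1) eG(1) by (auto intro: edge_in_points simp del: glue.simps)
    have near': "d (glue G (Inr e, r)) (\<psi> (glue (contract G F) (Inr e, r))) = 0" if "r \<in> {0..1}" for r
      using near[OF pts(1)[OF that]] eG by (simp add: contract_glue del: glue.simps)
    let ?x = "\<psi> (glue (contract G F) (Inr e, s))" and ?y = "\<psi> (glue (contract G F) (Inr e, t))"
    have "d ?x ?y \<le> d ?x (glue G (Inr e, s)) + d (glue G (Inr e, s)) ?y"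
      by (intro d_triangle \<psi> pts e)
    moreover have "d ?x (glue G (Inr e, s)) = d (glue G (Inr e, s)) ?x"
      by (intro d_sym \<psi> pts e)
    moreover have "d (glue G (Inr e, s)) ?y \<le> d (glue G (Inr e, s)) (glue G (Inr e, t)) + d (glue G (Inr e, t)) ?y"
      by (intro d_triangle \<psi> pts e)
    ultimately show "d ?x ?y \<le> m e * \<bar>s - t\<bar>"
      using near'[OF e(2)] near'[OF e(3)] d_edge[OF eG(1) e(2,3)] m[of e] eG by simp
  qed
qed

end

section \<open>Continuous dependence on the lengths\<close>

lemma chain_length_diff:
  assumes "chain G x cs y" "\<And>e. e \<in> edges G \<Longrightarrow> \<bar>m e - l e\<bar> \<le> \<eta>"
  shows "chain_length m cs \<le> chain_length l cs + \<eta> * real (length cs)"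
  using assms(1)
proof (induction cs arbitrary: x)
  case (Cons c cs)
  obtain e s t where c: "c = (e, s, t)" by (cases c)
  have e: "e \<in> edges G" "\<bar>s - t\<bar> \<le> 1" and IH: "chain_length m cs \<le> chain_length l cs + \<eta> * real (length cs)"
    using Cons.prems Cons.IH[of "glue G (Inr e, t)"] unfolding c by (auto simp del: glue.simps)
  have "(m e - l e) * \<bar>s - t\<bar> \<le> \<eta> * 1"
    using assms(2)[OF e(1)] e(2) by (intro mult_mono) auto
  then show ?case using IH unfolding c by (simp add: algebra_simps)
qed simp

text \<open>The estimate from below is multiplicative: positive lengths shrink by a factor close to 1 and
  a length 0 cannot shrink at all. Lengths 0 may however grow by an infinite factor, so the estimate
  from above compares only finitely many chains, joining the points of a fine net.\<close>

context weighted_graph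
begin

lemma d_lengths_lower:
  assumes "0 < \<epsilon>"
  shows "\<exists>\<eta>>0. \<forall>m. (\<forall>e\<in>edges G. 0 \<le> m e \<and> \<bar>m e - l e\<bar> < \<eta>) \<longrightarrow>
    (\<forall>x\<in>points G. \<forall>y\<in>points G. d x y \<le> path_dist G m x y + \<epsilon>)"
proof -
  obtain B where B: "\<And>x y. x \<in> points G \<Longrightarrow> y \<in> points G \<Longrightarrow> d x y \<le> B"
    using d_bounded by blast
  define \<theta> where "\<theta> = min 1 (\<epsilon> / (\<bar>B\<bar> + 1))"
  have \<theta>: "0 < \<theta>" "\<theta> \<le> 1" "\<theta> * \<bar>B\<bar> \<le> \<epsilon>"
  proof -
    show "0 < \<theta>" "\<theta> \<le> 1" using assms by (auto simp: \<theta>_def)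
    have "\<theta> * \<bar>B\<bar> \<le> \<epsilon> / (\<bar>B\<bar> + 1) * (\<bar>B\<bar> + 1)"
      using assms by (intro mult_mono) (auto simp: \<theta>_def)
    then show "\<theta> * \<bar>B\<bar> \<le> \<epsilon>" by simp
  qed
  define \<mu> where "\<mu> = Min (insert 1 (l ` {e \<in> edges G. 0 < l e}))"
  have fin: "finite (edges G)" using conn by (simp add: connected_graph_def)
  have \<mu>: "0 < \<mu>" "\<And>e. e \<in> edges G \<Longrightarrow> 0 < l e \<Longrightarrow> \<mu> \<le> l e"
    unfolding \<mu>_def using fin by (auto intro!: Min_le)
  show ?thesis
  proof (intro exI[of _ "\<theta> * \<mu>"] conjI allI impI ballI)
    show "0 < \<theta> * \<mu>" using \<theta> \<mu> by simp
  next
    fix m x y assume m: "\<forall>e\<in>edges G. 0 \<le> m e \<and> \<bar>m e - l e\<bar> < \<theta> * \<mu>"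
      and xy: "x \<in> points G" "y \<in> points G"
    have shrink: "(1 - \<theta>) * l e \<le> m e" if e: "e \<in> edges G" for e
    proof (cases "0 < l e")
      case True
      then have "\<theta> * \<mu> \<le> \<theta> * l e" using \<mu>(2)[OF e] \<theta> by simp
      moreover have "l e - \<theta> * \<mu> < m e" using bspec[OF m e] by linarith
      ultimately show ?thesis by (simp add: algebra_simps)
    next
      case False
      then show ?thesis using nonneg[OF e] m e by auto
    qed
    interpret M: weighted_graph G m by standard (use conn m in auto)
    have "(1 - \<theta>) * d x y \<le> path_dist G m x y"
    proof (rule M.d_ge[OF xy])
      fix cs assume cs: "chain G x cs y"
      have "(1 - \<theta>) * chain_length l cs \<le> chain_length m cs"
        using cs
      proof (induction cs arbitrary: x)
        case (Cons c cs)
        obtain e s t where c: "c = (e, s, t)" by (cases c)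
        have e: "e \<in> edges G" and IH: "(1 - \<theta>) * chain_length l cs \<le> chain_length m cs"
          using Cons.prems Cons.IH[of "glue G (Inr e, t)"] unfolding c by (auto simp del: glue.simps)
        have "((1 - \<theta>) * l e) * \<bar>s - t\<bar> \<le> m e * \<bar>s - t\<bar>"
          by (rule mult_right_mono[OF shrink[OF e]]) simp
        then show ?case using IH unfolding c by (simp add: distrib_left mult.assoc)
      qed simp
      moreover have "(1 - \<theta>) * d x y \<le> (1 - \<theta>) * chain_length l cs"
        using d_le[OF cs] \<theta> by (intro mult_left_mono) auto
      ultimately show "(1 - \<theta>) * d x y \<le> chain_length m cs" by linarith
    qed
    moreover have "\<theta> * d x y \<le> \<theta> * \<bar>B\<bar>"
      using B[OF xy] \<theta> by (intro mult_left_mono) auto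
    ultimately show "d x y \<le> path_dist G m x y + \<epsilon>" using \<theta>(3) by (simp add: algebra_simps)
  qed
qed

lemma fine_net:
  assumes "0 < \<delta>"
  obtains N where "finite N" "N \<subseteq> points G"
    "\<And>x. x \<in> points G \<Longrightarrow>
      \<exists>y\<in>N. \<forall>m. (\<forall>e\<in>edges G. 0 \<le> m e \<and> m e \<le> K) \<longrightarrow> path_dist G m x y \<le> \<delta>"
proof -
  have fin: "finite (edges G)" "finite (verts G)" using conn by (auto simp: connected_graph_def)
  obtain k :: nat where k: "\<bar>K\<bar> / \<delta> < real k" using reals_Archimedean2 by blast
  have k0: "0 < k" using k assms by (cases k) (auto simp: field_simps)
  define N where "N = (\<lambda>v. (Inl v, 0)) ` verts G \<union>
    (\<lambda>(e, i). glue G (Inr e, real i / real k)) ` (edges G \<times> {..k})"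
  show thesis
  proof (rule that[of N])
    show "finite N" unfolding N_def using fin by simp
    show "N \<subseteq> points G"
      unfolding N_def using k0 by (auto intro!: vertex_in_points edge_in_points simp del: glue.simps)
    fix x assume x: "x \<in> points G"
    then consider v where "v \<in> verts G" "x = (Inl v, 0)"
      | e s where "e \<in> edges G" "s \<in> {0..1}" "x = glue G (Inr e, s)"
      unfolding points_iff by blast
    then show "\<exists>y\<in>N. \<forall>m. (\<forall>e\<in>edges G. 0 \<le> m e \<and> m e \<le> K) \<longrightarrow> path_dist G m x y \<le> \<delta>"
    proof cases
      case 1
      then have "x \<in> N" by (simp add: N_def)
      moreover have "path_dist G m x x \<le> \<delta>" if "\<forall>e\<in>edges G. 0 \<le> m e \<and> m e \<le> K" for m
      proof -
        interpret M: weighted_graph G m by standard (use conn that in auto)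
        show ?thesis using M.d_refl[OF x] assms by simp
      qed
      ultimately show ?thesis by blast
    next
      case 2
      define i where "i = nat \<lfloor>s * real k\<rfloor>"
      have i: "real i \<le> s * real k" "s * real k \<le> real i + 1"
        using 2(2) mult_nonneg_nonneg[of s "real k"] unfolding i_def by auto
      have "s * real k \<le> 1 * real k" using 2(2) by (intro mult_right_mono) auto
      then have ik: "i \<le> k" using i(1) by linarith
      have i_bound: "\<bar>s - real i / real k\<bar> \<le> 1 / real k"
      proof -
        have "s - real i / real k = (s * real k - real i) / real k" using k0 by (simp add: field_simps)
        moreover have "\<bar>s * real k - real i\<bar> \<le> 1" using i by linarith
        ultimately show ?thesis by (simp add: divide_right_mono)
      qed
      have "path_dist G m x (glue G (Inr e, real i / real k)) \<le> \<delta>"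
        if m: "\<forall>e\<in>edges G. 0 \<le> m e \<and> m e \<le> K" for m
      proof -
        interpret M: weighted_graph G m by standard (use conn m in auto)
        have "M.d x (glue G (Inr e, real i / real k)) \<le> m e * \<bar>s - real i / real k\<bar>"
          unfolding 2(3) using 2 ik k0 by (intro M.d_edge) auto
        also have "\<dots> \<le> \<bar>K\<bar> * (1 / real k)"
          using m 2(1) i_bound by (intro mult_mono) auto
        also have "\<dots> \<le> \<delta>" using k k0 assms by (simp add: field_simps)
        finally show ?thesis .
      qed
      moreover have "glue G (Inr e, real i / real k) \<in> N"
        using 2(1) ik unfolding N_def by (intro UnI2 image_eqI[of _ _ "(e, i)"]) auto
      ultimately show ?thesis by blast
    qed
  qed
qed

lemma d_lengths_upper:
  assumes "0 < \<epsilon>"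
  shows "\<exists>\<eta>>0. \<forall>m. (\<forall>e\<in>edges G. 0 \<le> m e \<and> \<bar>m e - l e\<bar> < \<eta>) \<longrightarrow>
    (\<forall>x\<in>points G. \<forall>y\<in>points G. path_dist G m x y \<le> d x y + \<epsilon>)"
proof -
  have fin: "finite (edges G)" using conn by (simp add: connected_graph_def)
  define K where "K = (\<Sum>e\<in>edges G. l e) + 1"
  have K: "l e + 1 \<le> K" if "e \<in> edges G" for e
    unfolding K_def using member_le_sum[of e "edges G" l] that fin nonneg by auto
  have "0 < \<epsilon> / 8" using assms by simp
  then obtain N where N: "finite N" "N \<subseteq> points G"
    and net: "\<And>x. x \<in> points G \<Longrightarrow> \<exists>y\<in>N. \<forall>m. (\<forall>e\<in>edges G. 0 \<le> m e \<and> m e \<le> K) \<longrightarrow>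
      path_dist G m x y \<le> \<epsilon> / 8"
    using fine_net[of "\<epsilon> / 8" K] by blast
  have "\<forall>z\<in>N \<times> N. \<exists>cs. chain G (fst z) cs (snd z) \<and> chain_length l cs < d (fst z) (snd z) + \<epsilon> / 8"
    using N(2) d_approx[OF _ _ \<open>0 < \<epsilon> / 8\<close>] by (metis SigmaE fst_conv snd_conv subsetD)
  then obtain c where c: "\<And>z. z \<in> N \<times> N \<Longrightarrow> chain G (fst z) (c z) (snd z) \<and>
      chain_length l (c z) < d (fst z) (snd z) + \<epsilon> / 8"
    by metis
  define n where "n = (\<Sum>z\<in>N \<times> N. length (c z))"
  have n: "length (c z) \<le> n" if "z \<in> N \<times> N" for z
    unfolding n_def using that N(1) by (intro member_le_sum) auto
  define \<eta> where "\<eta> = min 1 (\<epsilon> / (8 * (real n + 1)))"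
  have \<eta>: "0 < \<eta>" "\<eta> \<le> 1" "\<eta> * real n \<le> \<epsilon> / 8"
  proof -
    show "0 < \<eta>" "\<eta> \<le> 1" using assms by (auto simp: \<eta>_def)
    have "\<eta> * real n \<le> \<epsilon> / (8 * (real n + 1)) * (real n + 1)"
      using assms by (intro mult_mono) (auto simp: \<eta>_def)
    also have "\<dots> = \<epsilon> / 8" by (simp add: field_simps)
    finally show "\<eta> * real n \<le> \<epsilon> / 8" .
  qed
  show ?thesis
  proof (intro exI[of _ \<eta>] conjI allI impI ballI \<eta>(1))
    fix m x y assume m: "\<forall>e\<in>edges G. 0 \<le> m e \<and> \<bar>m e - l e\<bar> < \<eta>"
      and xy: "x \<in> points G" "y \<in> points G"
    have mK: "\<forall>e\<in>edges G. 0 \<le> m e \<and> m e \<le> K" using m K \<eta>(2) by fastforce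
    have lK: "\<forall>e\<in>edges G. 0 \<le> l e \<and> l e \<le> K" using K nonneg by fastforce
    interpret M: weighted_graph G m by standard (use conn m in auto)
    obtain x' where x': "x' \<in> N" "d x x' \<le> \<epsilon> / 8" "M.d x x' \<le> \<epsilon> / 8"
      using net[OF xy(1)] mK lK by blast
    obtain y' where y': "y' \<in> N" "d y y' \<le> \<epsilon> / 8" "M.d y y' \<le> \<epsilon> / 8"
      using net[OF xy(2)] mK lK by blast
    have pts: "x' \<in> points G" "y' \<in> points G" using x' y' N(2) by auto
    have xy': "(x', y') \<in> N \<times> N" using x' y' by simp
    have "M.d x' y' \<le> chain_length m (c (x', y'))" using c[OF xy'] M.d_le by auto
    also have "\<dots> \<le> chain_length l (c (x', y')) + \<eta> * real (length (c (x', y')))"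
      by (rule chain_length_diff[of G x' _ y']) (use c[OF xy'] m in \<open>auto simp: less_imp_le\<close>)
    also have "\<dots> \<le> d x' y' + \<epsilon> / 8 + \<eta> * real n"
      using c[OF xy'] n[OF xy'] \<eta>(1) by (intro add_mono mult_left_mono) auto
    finally have "M.d x' y' \<le> d x' y' + \<epsilon> / 8 + \<epsilon> / 8" using \<eta>(3) by linarith
    moreover have "M.d x y \<le> M.d x x' + M.d x' y" "M.d x' y \<le> M.d x' y' + M.d y' y" "M.d y' y = M.d y y'"
      using M.d_triangle[OF xy(1) pts(1) xy(2)] M.d_triangle[OF pts xy(2)] M.d_sym[OF pts(2) xy(2)] by auto
    moreover have "d x' y' \<le> d x' x + d x y'" "d x y' \<le> d x y + d y y'" "d x' x = d x x'"
      using d_triangle[OF pts(1) xy(1) pts(2)] d_triangle[OF xy pts(2)] d_sym[OF pts(1) xy(1)] by auto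
    ultimately show "M.d x y \<le> d x y + \<epsilon>" using x'(2,3) y'(2,3) assms by linarith
  qed
qed

lemma d_lengths_close:
  assumes "0 < \<epsilon>"
  obtains \<eta> where "0 < \<eta>" "\<And>m x y. (\<forall>e\<in>edges G. 0 \<le> m e \<and> \<bar>m e - l e\<bar> < \<eta>) \<Longrightarrow>
    x \<in> points G \<Longrightarrow> y \<in> points G \<Longrightarrow> \<bar>path_dist G m x y - d x y\<bar> \<le> \<epsilon>"
proof -
  obtain \<eta>1 where 1: "0 < \<eta>1" "\<forall>m. (\<forall>e\<in>edges G. 0 \<le> m e \<and> \<bar>m e - l e\<bar> < \<eta>1) \<longrightarrow>
    (\<forall>x\<in>points G. \<forall>y\<in>points G. d x y \<le> path_dist G m x y + \<epsilon>)"
    using d_lengths_lower[OF assms] by blast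
  obtain \<eta>2 where 2: "0 < \<eta>2" "\<forall>m. (\<forall>e\<in>edges G. 0 \<le> m e \<and> \<bar>m e - l e\<bar> < \<eta>2) \<longrightarrow>
    (\<forall>x\<in>points G. \<forall>y\<in>points G. path_dist G m x y \<le> d x y + \<epsilon>)"
    using d_lengths_upper[OF assms] by blast
  show thesis
  proof (rule that[of "min \<eta>1 \<eta>2"])
    show "0 < min \<eta>1 \<eta>2" using 1 2 by simp
    fix m x y assume m: "\<forall>e\<in>edges G. 0 \<le> m e \<and> \<bar>m e - l e\<bar> < min \<eta>1 \<eta>2"
      and xy: "x \<in> points G" "y \<in> points G"
    have "d x y \<le> path_dist G m x y + \<epsilon>" "path_dist G m x y \<le> d x y + \<epsilon>"
      using 1(2) 2(2) m xy by auto
    then show "\<bar>path_dist G m x y - d x y\<bar> \<le> \<epsilon>" by linarith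
  qed
qed

lemma openin_ball:
  assumes x: "x \<in> points G"
  shows "openin (realization G) {y \<in> points G. d y x < \<epsilon>}"
proof -
  have "openin (cells G) {q \<in> topspace (cells G). d (glue G q) x < \<epsilon>}"
    unfolding cells_def openin_sum_topology
  proof (intro conjI ballI)
    fix c assume c: "c \<in> verts G <+> edges G"
    let ?T = "case_sum (\<lambda>v. top_of_set {0}) (\<lambda>e. top_of_set {0..1}) c :: real topology"
    have eq: "{s. (c, s) \<in> {q \<in> topspace (cells G). d (glue G q) x < \<epsilon>}} =
        {s \<in> topspace ?T. d (glue G (c, s)) x < \<epsilon>}"
      using c unfolding cells_def by auto
    have "continuous_map ?T euclideanreal (\<lambda>s. d (glue G (c, s)) x)"
    proof (cases c)
      case (Inl v)
      then show ?thesis by simp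
    next
      case (Inr e)
      have e: "e \<in> edges G" using c Inr by auto
      have "\<bar>d (glue G (Inr e, s)) x - d (glue G (Inr e, t)) x\<bar> \<le> l e * \<bar>s - t\<bar>"
        if "s \<in> {0..1}" "t \<in> {0..1}" for s t
      proof -
        note p = edge_in_points[OF e that(1)] edge_in_points[OF e that(2)]
        show ?thesis
          using d_triangle[OF p x] d_triangle[OF p(2,1) x] d_edge[OF e that] d_edge[OF e that(2,1)]
          by (simp add: abs_minus_commute del: glue.simps)
      qed
      then have "(l e)-lipschitz_on {0..1} (\<lambda>s. d (glue G (Inr e, s)) x)"
        using nonneg[OF e] by (auto simp: lipschitz_on_def dist_real_def)
      then show ?thesis using Inr by (simp add: lipschitz_on_continuous_on del: glue.simps)
    qed
    from openin_continuous_map_preimage[OF this, of "{..<\<epsilon>}"]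
    show "openin ?T {s. (c, s) \<in> {q \<in> topspace (sum_topology (case_sum (\<lambda>v. top_of_set {0})
        (\<lambda>e. top_of_set {0..1})) (verts G <+> edges G)). d (glue G q) x < \<epsilon>}}"
      unfolding eq[unfolded cells_def] by simp
  qed auto
  moreover have "{q \<in> topspace (cells G). glue G q \<in> {y \<in> points G. d y x < \<epsilon>}} =
      {q \<in> topspace (cells G). d (glue G q) x < \<epsilon>}"
    by (auto simp: realization_def simp del: glue.simps)
  ultimately show ?thesis
    unfolding realization_def openin_quotient_topology by (auto simp: realization_def)
qed

end

section \<open>Invariants of marked metric graphs\<close>

definition configurations :: "mgraph \<Rightarrow> point \<Rightarrow> (nat \<Rightarrow> point) set" where
  "configurations G p = {q. q 0 = p \<and> range q \<subseteq> points G}"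

text \<open>Such suprema are isometry invariants by construction, and they are insensitive to points at
  distance 0 from each other. In the pairs \<open>ps\<close>, index 0 stands for the marking.\<close>

definition spread :: "(nat \<times> nat) list \<Rightarrow> mgraph \<Rightarrow> (nat \<Rightarrow> real) \<Rightarrow> point \<Rightarrow> real" where
  "spread ps G l p = (SUP q\<in>configurations G p. \<Sum>(i, j)\<leftarrow>ps. path_dist G l (q i) (q j))"

lemma configurations_nonempty: "p \<in> points G \<Longrightarrow> configurations G p \<noteq> {}"
  unfolding configurations_def by (auto intro: exI[of _ "\<lambda>_. p"])

lemma spread_transfer:
  assumes "\<phi> ` points G = points H"
    and "\<And>x y. x \<in> points G \<Longrightarrow> y \<in> points G \<Longrightarrow> path_dist H m (\<phi> x) (\<phi> y) = path_dist G l x y"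
    and "p \<in> points G"
  shows "spread ps H m (\<phi> p) = spread ps G l p"
proof -
  have conf: "configurations H (\<phi> p) = (\<lambda>q. \<phi> \<circ> q) ` configurations G p"
  proof
    show "(\<lambda>q. \<phi> \<circ> q) ` configurations G p \<subseteq> configurations H (\<phi> p)"
      using assms(1) unfolding configurations_def by fastforce
    show "configurations H (\<phi> p) \<subseteq> (\<lambda>q. \<phi> \<circ> q) ` configurations G p"
    proof
      fix r assume r: "r \<in> configurations H (\<phi> p)"
      then have "\<forall>i. \<exists>x. x \<in> points G \<and> \<phi> x = r i"
        using assms(1) unfolding configurations_def by (metis (mono_tags, lifting) imageE mem_Collect_eq rangeI subsetD)
      then obtain q where q: "\<And>i. q i \<in> points G \<and> \<phi> (q i) = r i" by metis
      have "q(0 := p) \<in> configurations G p" using q assms(3) by (auto simp: configurations_def)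
      moreover have "\<phi> \<circ> q(0 := p) = r" using q r by (auto simp: configurations_def fun_eq_iff)
      ultimately show "r \<in> (\<lambda>q. \<phi> \<circ> q) ` configurations G p" by blast
    qed
  qed
  have "(\<Sum>(i, j)\<leftarrow>ps. path_dist H m ((\<phi> \<circ> q) i) ((\<phi> \<circ> q) j)) = (\<Sum>(i, j)\<leftarrow>ps. path_dist G l (q i) (q j))"
    if "q \<in> configurations G p" for q
  proof -
    have q: "q i \<in> points G" for i using that by (auto simp: configurations_def)
    show ?thesis by (simp add: assms(2)[OF q q])
  qed
  then show ?thesis
    unfolding spread_def conf image_image by (rule SUP_cong[OF refl])
qed

lemma spread_isometric:
  assumes "isometric n (G, l, p) (H, m, q)" "i \<in> {1..n}" "p i \<in> points G"
  shows "spread ps H m (q i) = spread ps G l (p i)"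
proof -
  obtain \<phi> where "bij_betw \<phi> (points G) (points H)" "\<phi> (p i) = q i"
    "\<And>x y. x \<in> points G \<Longrightarrow> y \<in> points G \<Longrightarrow> path_dist H m (\<phi> x) (\<phi> y) = path_dist G l x y"
    using assms unfolding isometric_def by blast
  then show ?thesis
    using spread_transfer[of \<phi> G H m l "p i" ps] assms(3) by (simp add: bij_betw_def)
qed

lemma sum_list_pairs_le:
  fixes f g :: "nat \<Rightarrow> nat \<Rightarrow> real"
  assumes "\<And>i j. f i j \<le> g i j + \<kappa>"
  shows "(\<Sum>(i, j)\<leftarrow>ps. f i j) \<le> (\<Sum>(i, j)\<leftarrow>ps. g i j) + real (length ps) * \<kappa>"
proof (induction ps)
  case (Cons z ps)
  then show ?case using assms[of "fst z" "snd z"] by (cases z) (simp add: algebra_simps)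
qed simp

context weighted_graph
begin

lemma bdd_above_configurations:
  "bdd_above ((\<lambda>q. \<Sum>(i, j)\<leftarrow>ps. d (q i) (q j)) ` configurations G p)"
proof -
  obtain B where B: "\<And>x y. x \<in> points G \<Longrightarrow> y \<in> points G \<Longrightarrow> d x y \<le> B"
    using d_bounded by blast
  have "(\<Sum>(i, j)\<leftarrow>ps. d (q i) (q j)) \<le> real (length ps) * B" if "q \<in> configurations G p" for q
  proof -
    have "q i \<in> points G" for i using that by (auto simp: configurations_def)
    then have "d (q i) (q j) \<le> 0 + B" for i j using B by simp
    then have "(\<Sum>(i, j)\<leftarrow>ps. d (q i) (q j)) \<le> (\<Sum>(i, j)\<leftarrow>ps. 0) + real (length ps) * B"
      by (rule sum_list_pairs_le)
    moreover have "(\<Sum>(i, j)\<leftarrow>ps. 0::real) = 0" by (induction ps) auto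
    ultimately show ?thesis by simp
  qed
  then show ?thesis by (auto simp: bdd_above_def)
qed

lemma spread_le_add:
  assumes m: "weighted_graph G m" and p: "p \<in> points G" and q: "q \<in> points G"
    and close: "\<And>x y. x \<in> points G \<Longrightarrow> y \<in> points G \<Longrightarrow> d x y \<le> path_dist G m x y + \<epsilon>"
    and pq: "d p q \<le> \<epsilon>"
  shows "spread ps G l p \<le> spread ps G m q + real (length ps) * (3 * \<epsilon>)"
  unfolding spread_def
proof (rule cSUP_least[OF configurations_nonempty[OF p]])
  interpret M: weighted_graph G m by fact
  fix r assume r: "r \<in> configurations G p"
  then have rp: "r i \<in> points G" for i by (auto simp: configurations_def)
  define r' where "r' = r(0 := q)"
  have r': "r' \<in> configurations G q" using r q by (auto simp: configurations_def r'_def)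
  then have rp': "r' i \<in> points G" for i by (auto simp: configurations_def)
  have "0 \<le> \<epsilon>" using d_nonneg[OF p q] pq by simp
  then have near: "d (r i) (r' i) \<le> \<epsilon>" for i
    using r pq d_refl[OF rp] by (auto simp: r'_def configurations_def)
  have "d (r i) (r j) \<le> M.d (r' i) (r' j) + 3 * \<epsilon>" for i j
    using d_triangle[OF rp[of i] rp'[of i] rp[of j]] d_triangle[OF rp'[of i] rp'[of j] rp[of j]]
      d_sym[OF rp'[of j] rp[of j]] near[of i] near[of j] close[OF rp'[of i] rp'[of j]] by linarith
  then have "(\<Sum>(i, j)\<leftarrow>ps. d (r i) (r j)) \<le>
      (\<Sum>(i, j)\<leftarrow>ps. M.d (r' i) (r' j)) + real (length ps) * (3 * \<epsilon>)"
    by (rule sum_list_pairs_le)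
  also have "(\<Sum>(i, j)\<leftarrow>ps. M.d (r' i) (r' j)) \<le>
      (SUP q\<in>configurations G q. \<Sum>(i, j)\<leftarrow>ps. M.d (q i) (q j))"
    by (rule cSUP_upper[OF r' M.bdd_above_configurations])
  finally show "(\<Sum>(i, j)\<leftarrow>ps. d (r i) (r j)) \<le>
    (SUP q\<in>configurations G q. \<Sum>(i, j)\<leftarrow>ps. M.d (q i) (q j)) + real (length ps) * (3 * \<epsilon>)"
    by simp
qed

end

section \<open>Continuity of the invariants on the moduli space\<close>

lemma continuous_map_real_locally:
  fixes f :: "'a \<Rightarrow> real"
  assumes "\<And>z \<epsilon>. z \<in> topspace X \<Longrightarrow> 0 < \<epsilon> \<Longrightarrow> \<exists>U. openin X U \<and> z \<in> U \<and> (\<forall>w\<in>U. \<bar>f w - f z\<bar> < \<epsilon>)"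
  shows "continuous_map X euclideanreal f"
  unfolding continuous_map_def
proof (intro conjI allI impI)
  fix V :: "real set" assume "openin euclideanreal V"
  then have V: "open V" by simp
  show "openin X {x \<in> topspace X. f x \<in> V}"
  proof (subst openin_subopen, intro ballI)
    fix z assume z: "z \<in> {x \<in> topspace X. f x \<in> V}"
    then obtain \<epsilon> where e: "0 < \<epsilon>" "\<And>r. \<bar>r - f z\<bar> < \<epsilon> \<Longrightarrow> r \<in> V"
      using V unfolding open_dist dist_real_def by blast
    obtain U where U: "openin X U" "z \<in> U" "\<forall>w\<in>U. \<bar>f w - f z\<bar> < \<epsilon>"
      using assms[of z \<epsilon>] z e by blast
    then show "\<exists>T. openin X T \<and> z \<in> T \<and> T \<subseteq> {x \<in> topspace X. f x \<in> V}"
      using e openin_subset[OF U(1)] by (intro exI[of _ U]) auto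
  qed
qed auto

lemma topspace_length_space:
  "topspace (length_space G) = {l \<in> edges G \<rightarrow>\<^sub>E {0..}. is_forest G (zero_edges G l)}"
  by (auto simp: length_space_def)

lemma spread_continuous:
  assumes G: "connected_graph G" and i: "i \<in> {1..n}"
  shows "continuous_map (prod_topology (length_space G) (product_topology (\<lambda>i. realization G) {1..n}))
    euclideanreal (\<lambda>(l, p). spread ps G l (p i))"
proof (rule continuous_map_real_locally)
  let ?P = "product_topology (\<lambda>i. realization G) {1..n}"
  fix z and \<epsilon> :: real
  assume "z \<in> topspace (prod_topology (length_space G) ?P)" and \<epsilon>: "0 < \<epsilon>"
  then obtain l p where z: "z = (l, p)" and l: "l \<in> topspace (length_space G)" and p: "p \<in> topspace ?P"
    by auto
  have fin: "finite (edges G)" using G by (simp add: connected_graph_def)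
  interpret weighted_graph G l
    by standard (use G l in \<open>auto simp: topspace_length_space PiE_iff\<close>)
  have pi: "p i \<in> points G" using p i by auto
  define \<kappa> where "\<kappa> = \<epsilon> / (6 * real (length ps) + 1)"
  have \<kappa>: "0 < \<kappa>" using \<epsilon> by (simp add: \<kappa>_def)
  have "(6 * real (length ps) + 1) * \<kappa> = \<epsilon>" by (simp add: \<kappa>_def)
  then have total: "real (length ps) * (3 * (2 * \<kappa>)) < \<epsilon>" using \<kappa> by (simp add: algebra_simps)
  obtain \<eta> where \<eta>: "0 < \<eta>" and close: "\<And>m x y. (\<forall>e\<in>edges G. 0 \<le> m e \<and> \<bar>m e - l e\<bar> < \<eta>) \<Longrightarrow>
    x \<in> points G \<Longrightarrow> y \<in> points G \<Longrightarrow> \<bar>path_dist G m x y - d x y\<bar> \<le> \<kappa>"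
    using d_lengths_close[OF \<kappa>] by blast
  define U where "U = {m. is_forest G (zero_edges G m)} \<inter> (\<Pi>\<^sub>E e\<in>edges G. {0..} \<inter> {l e - \<eta><..<l e + \<eta>})"
  define V where "V = {q \<in> topspace ?P. q i \<in> {x \<in> points G. d x (p i) < \<kappa>}}"
  have openU: "openin (length_space G) U"
    unfolding U_def length_space_def
    by (subst Int_commute, rule openin_subtopology_Int)
      (simp add: openin_PiE fin openin_open_Int)
  have openV: "openin ?P V"
    unfolding V_def
    by (rule openin_continuous_map_preimage[OF continuous_map_product_projection[OF i] openin_ball[OF pi]])
  show "\<exists>W. openin (prod_topology (length_space G) ?P) W \<and> z \<in> W \<and>
      (\<forall>w\<in>W. \<bar>(case w of (l, p) \<Rightarrow> spread ps G l (p i)) - (case z of (l, p) \<Rightarrow> spread ps G l (p i))\<bar> < \<epsilon>)"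
  proof (intro exI[of _ "U \<times> V"] conjI ballI)
    show "openin (prod_topology (length_space G) ?P) (U \<times> V)"
      using openU openV by (simp add: openin_prod_Times_iff)
    show "z \<in> U \<times> V"
      using l p \<eta> \<kappa> pi d_refl[OF pi] unfolding z U_def V_def
      by (auto simp: topspace_length_space PiE_iff)
  next
    fix w assume "w \<in> U \<times> V"
    then obtain m q where w: "w = (m, q)" "m \<in> U" "q \<in> V" by blast
    then have m: "\<forall>e\<in>edges G. 0 \<le> m e \<and> \<bar>m e - l e\<bar> < \<eta>"
      by (auto simp: U_def PiE_iff abs_less_iff)
    have q: "q i \<in> points G" "d (q i) (p i) < \<kappa>" using w by (auto simp: V_def)
    have M: "weighted_graph G m" by standard (use G m in auto)
    interpret M: weighted_graph G m by (rule M)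
    have "spread ps G l (p i) \<le> spread ps G m (q i) + real (length ps) * (3 * (2 * \<kappa>))"
    proof (rule spread_le_add[OF M pi q(1)])
      show "d x y \<le> M.d x y + 2 * \<kappa>" if "x \<in> points G" "y \<in> points G" for x y
        using close[OF m that] \<kappa> by linarith
      show "d (p i) (q i) \<le> 2 * \<kappa>" using q(2) \<kappa> d_sym[OF q(1) pi] by simp
    qed
    moreover have "spread ps G m (q i) \<le> spread ps G l (p i) + real (length ps) * (3 * (2 * \<kappa>))"
    proof (rule M.spread_le_add[OF weighted_graph_axioms q(1) pi])
      show "M.d x y \<le> d x y + 2 * \<kappa>" if "x \<in> points G" "y \<in> points G" for x y
        using close[OF m that] \<kappa> by linarith
      show "M.d (q i) (p i) \<le> 2 * \<kappa>" using q close[OF m q(1) pi] by linarith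
    qed
    ultimately show "\<bar>(case w of (l, p) \<Rightarrow> spread ps G l (p i)) - (case z of (l, p) \<Rightarrow> spread ps G l (p i))\<bar> < \<epsilon>"
      using total w z by simp
  qed
qed

lemma isometric_refl: "isometric n t t"
  by (cases t) (auto simp: isometric_def intro!: exI[of _ id])

lemma isometric_sym:
  assumes t: "isometric n (G, l, p) (H, m, q)" and p: "\<And>i. i \<in> {1..n} \<Longrightarrow> p i \<in> points G"
  shows "isometric n (H, m, q) (G, l, p)"
proof -
  from t obtain \<phi> where \<phi>: "bij_betw \<phi> (points G) (points H)"
    "\<And>x y. x \<in> points G \<Longrightarrow> y \<in> points G \<Longrightarrow> path_dist H m (\<phi> x) (\<phi> y) = path_dist G l x y"
    "\<And>i. i \<in> {1..n} \<Longrightarrow> \<phi> (p i) = q i"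
    unfolding isometric_def by blast
  let ?\<psi> = "inv_into (points G) \<phi>"
  have \<psi>: "?\<psi> x \<in> points G" "\<phi> (?\<psi> x) = x" if "x \<in> points H" for x
    using that \<phi>(1) by (auto simp: bij_betw_def inv_into_into f_inv_into_f)
  have "path_dist G l (?\<psi> x) (?\<psi> y) = path_dist H m x y" if "x \<in> points H" "y \<in> points H" for x y
    using \<phi>(2)[of "?\<psi> x" "?\<psi> y"] \<psi> that by simp
  moreover have "?\<psi> (q i) = p i" if "i \<in> {1..n}" for i
  proof -
    show ?thesis using \<phi>(3)[OF that] bij_betw_inv_into_left[OF \<phi>(1) p[OF that]] by simp
  qed
  ultimately show ?thesis
    unfolding isometric_def using bij_betw_inv_into[OF \<phi>(1)] by blast
qed

lemma isometric_trans:
  assumes "isometric n t t'" "isometric n t' t''"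
  shows "isometric n t t''"
proof -
  obtain G l p where t: "t = (G, l, p)" by (cases t)
  obtain H m q where t': "t' = (H, m, q)" by (cases t')
  obtain K k r where t'': "t'' = (K, k, r)" by (cases t'')
  obtain \<phi> where \<phi>: "bij_betw \<phi> (points G) (points H)"
    "\<forall>x\<in>points G. \<forall>y\<in>points G. path_dist H m (\<phi> x) (\<phi> y) = path_dist G l x y"
    "\<forall>i\<in>{1..n}. \<phi> (p i) = q i"
    using assms(1) unfolding t t' isometric_def by blast
  obtain \<psi> where \<psi>: "bij_betw \<psi> (points H) (points K)"
    "\<forall>x\<in>points H. \<forall>y\<in>points H. path_dist K k (\<psi> x) (\<psi> y) = path_dist H m x y"
    "\<forall>i\<in>{1..n}. \<psi> (q i) = r i"
    using assms(2) unfolding t' t'' isometric_def by blast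
  have "path_dist K k ((\<psi> \<circ> \<phi>) x) ((\<psi> \<circ> \<phi>) y) = path_dist G l x y"
    if "x \<in> points G" "y \<in> points G" for x y
    using \<phi>(2) \<psi>(2) bij_betwE[OF \<phi>(1)] that by simp
  moreover have "\<forall>i\<in>{1..n}. (\<psi> \<circ> \<phi>) (p i) = r i" using \<phi> \<psi> by auto
  ultimately show ?thesis
    unfolding t t'' isometric_def using bij_betw_trans[OF \<phi>(1) \<psi>(1)] by blast
qed

lemma iso_class_eqI:
  assumes "t \<in> marked_metric_graphs g n" "isometric n t t'"
  shows "iso_class g n t = iso_class g n t'"
proof -
  have "isometric n t' t"
  proof (cases t, cases t')
    fix G l p H m q assume t: "t = (G, l, p)" "t' = (H, m, q)"
    then have "p i \<in> points G" if "i \<in> {1..n}" for i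
      using assms(1) that by (auto simp: marked_metric_graphs_def)
    then show ?thesis using assms(2) isometric_sym[of n G l p H m q] unfolding t by blast
  qed
  then show ?thesis
    using assms(2) isometric_trans unfolding iso_class_def by blast
qed

lemma weighted_marked: "(G, l, p) \<in> marked_metric_graphs g n \<Longrightarrow> weighted_graph G l"
  by (auto simp: marked_metric_graphs_def weighted_graph_def stable_graph_def PiE_iff less_imp_le)

definition class_spread :: "(nat \<times> nat) list \<Rightarrow> nat \<Rightarrow> marked_graph set \<Rightarrow> real" where
  "class_spread ps i c = (case SOME t. t \<in> c of (G, l, p) \<Rightarrow> spread ps G l (p i))"

lemma class_spread_iso_class:
  assumes t: "(G, l, p) \<in> marked_metric_graphs g n" and i: "i \<in> {1..n}"
  shows "class_spread ps i (iso_class g n (G, l, p)) = spread ps G l (p i)"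
proof -
  let ?c = "iso_class g n (G, l, p)"
  obtain H m q where Hmq: "(SOME t. t \<in> ?c) = (H, m, q)" by (metis surj_pair)
  have "(G, l, p) \<in> ?c" using t isometric_refl by (simp add: iso_class_def)
  then have "(H, m, q) \<in> ?c" using Hmq by (metis someI)
  then have "isometric n (G, l, p) (H, m, q)" by (simp add: iso_class_def)
  then have "spread ps H m (q i) = spread ps G l (p i)"
    using t i by (intro spread_isometric) (auto simp: marked_metric_graphs_def)
  then show ?thesis by (simp add: class_spread_def Hmq)
qed

lemma spread_contract_marked:
  assumes G: "connected_graph G" and l: "l \<in> topspace (length_space G)"
    and p: "p i \<in> points G" and i: "i \<in> {1..n}"
    and c: "contract_marked n (G, l, p) = (H, m, q)"
  shows "spread ps H m (q i) = spread ps G l (p i)"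
proof -
  define F where "F = zero_edges G l"
  interpret weighted_graph G l
    by standard (use G l in \<open>auto simp: topspace_length_space PiE_iff\<close>)
  have H: "H = contract G F" and m: "m = restrict l (edges G - F)" and q: "q i = contract_point G F (p i)"
    using c i by (auto simp: contract_marked_def Let_def F_def)
  have F: "F \<subseteq> edges G" "\<And>e. e \<in> F \<Longrightarrow> l e = 0" by (auto simp: F_def zero_edges_def)
  have "m e = l e" if "e \<in> edges G - F" for e using that unfolding m by simp
  then show ?thesis
    unfolding H q
    by (intro spread_transfer contract_points G p path_dist_contract F)
qed

text \<open>Contraction has to stay among the stable graphs for a class to have a member on which
  the invariant can be computed.\<close>

lemma class_spread_continuous:
  assumes "\<And>G l p. stable_graph G \<Longrightarrow> genus G = int g \<Longrightarrow> l \<in> topspace (length_space G) \<Longrightarrow>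
      p \<in> {1..n} \<rightarrow>\<^sub>E points G \<Longrightarrow> contract_marked n (G, l, p) \<in> marked_metric_graphs g n"
    and i: "i \<in> {1..n}"
  shows "continuous_map (TM_space g n) euclideanreal (class_spread ps i)"
  unfolding TM_space_def
proof (rule continuous_compose_quotient_map[OF quotient_map_quotient_topology])
  let ?I = "{G. stable_graph G \<and> genus G = int g}"
  let ?Y = "\<lambda>G. prod_topology (length_space G) (product_topology (\<lambda>i. realization G) {1..n})"
  let ?h = "class_spread ps i \<circ> (\<lambda>t. iso_class g n (contract_marked n t))"
  have h: "?h (G, l, p) = spread ps G l (p i)" if "G \<in> ?I" "(l, p) \<in> topspace (?Y G)" for G l p
  proof -
    have l: "l \<in> topspace (length_space G)" and p: "p \<in> {1..n} \<rightarrow>\<^sub>E points G" using that(2) by auto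
    obtain H m q where c: "contract_marked n (G, l, p) = (H, m, q)" by (metis surj_pair)
    have "(H, m, q) \<in> marked_metric_graphs g n"
      unfolding c[symmetric] using that(1) l p by (intro assms) auto
    then have "?h (G, l, p) = spread ps H m (q i)" 
      using class_spread_iso_class[OF _ i] by (simp add: c)
    also have "\<dots> = spread ps G l (p i)"
      using that p i by (intro spread_contract_marked[OF _ l _ i c]) (auto simp: stable_graph_def)
    finally show ?thesis .
  qed
  show "continuous_map (sum_topology ?Y ?I) euclideanreal ?h"
    unfolding continuous_map_def
  proof (intro conjI allI impI)
    fix U :: "real set" assume U: "openin euclideanreal U"
    show "openin (sum_topology ?Y ?I) {x \<in> topspace (sum_topology ?Y ?I). ?h x \<in> U}"
      unfolding openin_sum_topology
    proof (intro conjI ballI)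
      fix G assume G: "G \<in> ?I"
      have "{x. (G, x) \<in> {x \<in> topspace (sum_topology ?Y ?I). ?h x \<in> U}} =
          {x \<in> topspace (?Y G). (case x of (l, p) \<Rightarrow> spread ps G l (p i)) \<in> U}"
      proof (rule set_eqI)
        fix x :: "(nat \<Rightarrow> real) \<times> (nat \<Rightarrow> point)"
        obtain l p where x: "x = (l, p)" by (cases x)
        have "(G, x) \<in> topspace (sum_topology ?Y ?I) \<longleftrightarrow> x \<in> topspace (?Y G)"
          using G unfolding topspace_sum_topology mem_Sigma_iff o_def by blast
        then show "x \<in> {x. (G, x) \<in> {x \<in> topspace (sum_topology ?Y ?I). ?h x \<in> U}} \<longleftrightarrow>
            x \<in> {x \<in> topspace (?Y G). (case x of (l, p) \<Rightarrow> spread ps G l (p i)) \<in> U}"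
          using h[OF G, of l p] x by auto
      qed
      moreover have "openin (?Y G) {x \<in> topspace (?Y G). (case x of (l, p) \<Rightarrow> spread ps G l (p i)) \<in> U}"
        using G U by (intro openin_continuous_map_preimage[OF spread_continuous[OF _ i]])
          (auto simp: stable_graph_def)
      ultimately show "openin (?Y G) {x. (G, x) \<in> {x \<in> topspace (sum_topology ?Y ?I). ?h x \<in> U}}"
        by simp
    qed auto
  qed auto
qed

section \<open>Stable graphs of genus 2\<close>

definition theta_graph :: "mgraph \<Rightarrow> bool" where
  "theta_graph G \<longleftrightarrow> (\<exists>u v. u \<noteq> v \<and> verts G = {u, v} \<and> card (edges G) = 3 \<and> (\<forall>e\<in>edges G. joins G e u v))"

definition rose_graph :: "mgraph \<Rightarrow> bool" where
  "rose_graph G \<longleftrightarrow> (\<exists>u. verts G = {u} \<and> card (edges G) = 2 \<and> (\<forall>e\<in>edges G. tail G e = u \<and> head G e = u))"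

lemma verts_eq_singleton_if_isolated:
  assumes "connects G F" "v \<in> verts G" "\<And>e. e \<in> F \<Longrightarrow> tail G e = v \<longleftrightarrow> head G e = v"
  shows "verts G = {v}"
proof -
  have "w = v" if "(v, w) \<in> (adj G F)\<^sup>*" for w
    using that by induction (use assms(3) in \<open>auto simp: adj_def joins_def\<close>)
  then show ?thesis using assms(1,2) by (auto simp: connects_def)
qed

text \<open>There are two edges other than loops at the vertex, since one alone would be a bridge. If
  there were just these two and no loop, the valency would be a forbidden 2.\<close>

lemma valency_stable:
  assumes G: "stable_graph G" and v: "v \<in> verts G" "verts G \<noteq> {v}"
  shows "3 \<le> valency G v"
    and "e \<in> edges G \<Longrightarrow> tail G e = v \<Longrightarrow> head G e = v \<Longrightarrow> 4 \<le> valency G v"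
proof -
  have fin: "finite (edges G)" and conn: "connects G (edges G)"
    using G by (auto simp: stable_graph_def connected_graph_def)
  define N where "N = {e \<in> edges G. (tail G e = v) \<noteq> (head G e = v)}"
  define L where "L = {e \<in> edges G. tail G e = v \<and> head G e = v}"
  have finN: "finite N" "finite L" unfolding N_def L_def using fin by auto
  have val: "valency G v = card N + 2 * card L"
  proof -
    have "{e \<in> edges G. tail G e = v} = {e \<in> N. tail G e = v} \<union> L"
      and "{e \<in> edges G. head G e = v} = {e \<in> N. head G e = v} \<union> L"
      and N: "N = {e \<in> N. tail G e = v} \<union> {e \<in> N. head G e = v}"
      unfolding N_def L_def by auto
    moreover have "card ({e \<in> N. tail G e = v} \<union> L) = card {e \<in> N. tail G e = v} + card L"
      and "card ({e \<in> N. head G e = v} \<union> L) = card {e \<in> N. head G e = v} + card L"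
      using finN(2) by (auto intro!: card_Un_disjoint finite_subset[OF _ fin] simp: N_def L_def)
    moreover have "card ({e \<in> N. tail G e = v} \<union> {e \<in> N. head G e = v}) =
        card {e \<in> N. tail G e = v} + card {e \<in> N. head G e = v}"
      by (intro card_Un_disjoint) (auto intro: finite_subset[OF _ fin] simp: N_def)
    ultimately show ?thesis unfolding valency_def by simp
  qed
  obtain e where e: "e \<in> N"
    using verts_eq_singleton_if_isolated[OF conn v(1)] v(2) unfolding N_def by blast
  then have "connects G (edges G - {e})"
    using G by (auto simp: stable_graph_def bridge_def N_def)
  then obtain f where f: "f \<in> N" "f \<noteq> e"
    using verts_eq_singleton_if_isolated[of G "edges G - {e}" v] v unfolding N_def by blast
  have "card {e, f} \<le> card N" using e f finN by (intro card_mono) auto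
  then have two: "2 \<le> card N" using f by simp
  show "3 \<le> valency G v"
  proof (rule ccontr)
    assume "\<not> 3 \<le> valency G v"
    then have "valency G v = 2" "card L = 0" using two val by auto
    then show False using G v finN by (auto simp: stable_graph_def L_def)
  qed
  show "4 \<le> valency G v" if "e \<in> edges G" "tail G e = v" "head G e = v" for e
  proof -
    have "L \<noteq> {}" using that by (auto simp: L_def)
    then have "1 \<le> card L" using finN by (simp add: Suc_leI card_gt_0_iff)
    then show ?thesis using two val by simp
  qed
qed

lemma handshake:
  assumes G: "connected_graph G"
  shows "(\<Sum>v\<in>verts G. valency G v) = 2 * card (edges G)"
proof -
  have fin: "finite (edges G)" "finite (verts G)" using G by (auto simp: connected_graph_def)
  have count: "(\<Sum>v\<in>verts G. card {e \<in> edges G. f e = v}) = card (edges G)"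
    if "f ` edges G \<subseteq> verts G" for f
  proof -
    have "card (\<Union>v\<in>verts G. {e \<in> edges G. f e = v}) = (\<Sum>v\<in>verts G. card {e \<in> edges G. f e = v})"
      by (rule card_UN_disjoint) (use fin in auto)
    moreover have "(\<Union>v\<in>verts G. {e \<in> edges G. f e = v}) = edges G" using that by auto
    ultimately show ?thesis by simp
  qed
  show ?thesis
    unfolding valency_def sum.distrib using ends_in_verts[OF G]
    by (subst (1 2) count) auto
qed

text \<open>The valencies are at least 3 and sum to twice the number of edges, and there is just one
  edge more than there are vertices; so there are at most two vertices, and if there are two, both have valency exactly 3.
  A loop would force valency 4.\<close>

lemma stable_genus_2_cases:
  assumes G: "stable_graph G" "genus G = 2"
  shows "theta_graph G \<or> rose_graph G"
proof -
  have conn: "connected_graph G" using G by (simp add: stable_graph_def)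
  then have fin: "finite (edges G)" "finite (verts G)" "verts G \<noteq> {}"
    by (auto simp: connected_graph_def)
  have E: "card (edges G) = card (verts G) + 1" using G(2) by (simp add: genus_def)
  show ?thesis
  proof (cases "\<exists>v. verts G = {v}")
    case True
    then show ?thesis
      using E ends_in_verts[OF conn] by (auto simp: rose_graph_def)
  next
    case False
    then have val: "3 \<le> valency G v" if "v \<in> verts G" for v
      using valency_stable(1)[OF G(1) that] by blast
    then have "(\<Sum>v\<in>verts G. 3) \<le> (\<Sum>v\<in>verts G. valency G v)" by (rule sum_mono)
    then have "card (verts G) \<le> 2" using handshake[OF conn] E by simp
    moreover have "card (verts G) \<noteq> 0" "card (verts G) \<noteq> 1"
      using fin False by (auto simp: card_1_singleton_iff)
    ultimately have V2: "card (verts G) = 2" by linarith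
    then obtain u v where uv: "verts G = {u, v}" "u \<noteq> v" by (auto simp: card_2_iff)
    have E3: "card (edges G) = 3" using E V2 by simp
    have "valency G u + valency G v = 6" using handshake[OF conn] E3 uv by simp
    then have vals: "valency G w = 3" if "w \<in> verts G" for w
      using val[of u] val[of v] that uv by auto
    have "joins G e u v" if e: "e \<in> edges G" for e
    proof -
      have "tail G e \<noteq> head G e"
      proof
        assume "tail G e = head G e"
        then have "4 \<le> valency G (tail G e)"
          using e ends_in_verts[OF conn e] False by (intro valency_stable(2)[OF G(1)]) auto
        then show False using vals ends_in_verts[OF conn e] by simp
      qed
      then show ?thesis using ends_in_verts[OF conn e] uv by (auto simp: joins_def)
    qed
    then show ?thesis using uv E3 by (auto simp: theta_graph_def)
  qed
qed

lemma loop_not_in_forest: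
  "is_forest G F \<Longrightarrow> e \<in> F \<Longrightarrow> tail G e \<in> verts G \<Longrightarrow> tail G e \<noteq> head G e"
proof
  assume "is_forest G F" "e \<in> F" "tail G e \<in> verts G" "tail G e = head G e"
  moreover from this have "is_cycle G [tail G e] [e]"
    by (auto simp: is_cycle_def is_forest_def joins_def)
  ultimately show False unfolding is_forest_def by fastforce
qed

lemma parallel_not_in_forest:
  assumes "is_forest G F" "e \<in> F" "f \<in> F" "joins G e u v" "joins G f u v" "u \<noteq> v" "u \<in> verts G" "v \<in> verts G"
  shows "e = f"
proof (rule ccontr)
  assume "e \<noteq> f"
  then have "is_cycle G [u, v] [e, f]"
    using assms by (auto simp: is_cycle_def is_forest_def joins_def less_Suc_eq)
  then show False using assms unfolding is_forest_def by fastforce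
qed

lemma merged_empty: "merged G {} v = v"
  by (simp add: merged_def adj_def) (rule Least_equality, auto)

lemma contract_empty: "contract G {} = G"
  by (simp add: contract_def merged_empty)

lemma contract_point_empty: "contract_point G {} x = x"
proof (cases x)
  case (Pair c s)
  then show ?thesis by (cases c) (simp_all add: merged_empty)
qed

lemma stable_if_rose: "connected_graph G \<Longrightarrow> rose_graph G \<Longrightarrow> stable_graph G"
proof -
  assume G: "connected_graph G" "rose_graph G"
  then obtain u where u: "verts G = {u}" "card (edges G) = 2" "\<forall>e\<in>edges G. tail G e = u \<and> head G e = u"
    by (auto simp: rose_graph_def)
  then have "{e \<in> edges G. tail G e = u} = edges G" "{e \<in> edges G. head G e = u} = edges G" by auto
  then have "valency G u = 4" using u by (simp add: valency_def)
  then show ?thesis using G u by (auto simp: stable_graph_def bridge_def connects_def)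
qed

lemma contract_theta:
  assumes "connected_graph G" "theta_graph G" "e \<in> edges G"
  shows "rose_graph (contract G {e})"
proof -
  obtain u v where uv: "u \<noteq> v" "verts G = {u, v}" "card (edges G) = 3" "\<forall>e\<in>edges G. joins G e u v"
    using assms by (auto simp: theta_graph_def)
  have "merged G {e} u = merged G {e} v"
    using merged_ends[of e "{e}" G] uv(4) assms(3) by (auto simp: joins_def)
  moreover have "card (edges G - {e}) = 2" using uv assms(3) by simp
  moreover have "tail G f \<in> {u, v} \<and> head G f \<in> {u, v}" if "f \<in> edges G" for f
    using ends_in_verts[OF assms(1) that] uv by simp
  ultimately have "verts (contract G {e}) = {merged G {e} v} \<and> card (edges (contract G {e})) = 2 \<and>
      (\<forall>f\<in>edges (contract G {e}). tail (contract G {e}) f = merged G {e} v \<and> head (contract G {e}) f = merged G {e} v)"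
    using uv(2) by (fastforce simp: contract_def)
  then show ?thesis unfolding rose_graph_def by blast
qed

lemma contract_marked_in_marked_metric_graphs:
  assumes G: "stable_graph G" "genus G = int 2" and l: "l \<in> topspace (length_space G)"
    and p: "p \<in> {1..n} \<rightarrow>\<^sub>E points G"
  shows "contract_marked n (G, l, p) \<in> marked_metric_graphs 2 n"
proof -
  define F where "F = zero_edges G l"
  have conn: "connected_graph G" using G by (simp add: stable_graph_def)
  have forest: "is_forest G F" using l by (simp add: topspace_length_space F_def)
  have FE: "F \<subseteq> edges G" by (auto simp: F_def zero_edges_def)
  have "stable_graph (contract G F) \<and> genus (contract G F) = 2"
  proof (cases "F = {}")
    case True
    then show ?thesis using G by (simp add: contract_empty)
  next
    case False
    then obtain e where e: "e \<in> F" by blast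
    have "tail G e \<noteq> head G e"
      using loop_not_in_forest[OF forest e] ends_in_verts[OF conn] e FE by blast
    then have "\<not> rose_graph G" using e FE unfolding rose_graph_def by (metis subsetD)
    then have theta: "theta_graph G" using stable_genus_2_cases[of G] G by simp
    then obtain u v where uv: "u \<noteq> v" "verts G = {u, v}" "\<forall>e\<in>edges G. joins G e u v"
      by (auto simp: theta_graph_def)
    have "f = e" if "f \<in> F" for f
      by (rule parallel_not_in_forest[OF forest that e]) (use uv that e FE in auto)
    then have F: "F = {e}" using e by blast
    then have rose: "rose_graph (contract G F)" using contract_theta[OF conn theta] e FE by blast
    then show ?thesis
      using stable_if_rose[OF connected_contract[OF conn FE] rose] by (auto simp: rose_graph_def genus_def)
  qed
  moreover have "restrict l (edges G - F) \<in> edges (contract G F) \<rightarrow>\<^sub>E {0<..}"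
  proof (rule PiE_I)
    fix e assume "e \<in> edges (contract G F)"
    then have e: "e \<in> edges G" "e \<notin> F" by (auto simp: contract_def)
    then have "l e \<noteq> 0" by (auto simp: F_def zero_edges_def)
    moreover have "0 \<le> l e" using l e by (auto simp: topspace_length_space)
    ultimately show "restrict l (edges G - F) e \<in> {0<..}" using e by simp
  qed (auto simp: contract_def restrict_def)
  moreover have "(\<lambda>i\<in>{1..n}. contract_point G F (p i)) \<in> {1..n} \<rightarrow>\<^sub>E points (contract G F)"
    using p contract_points[OF conn, of F] by auto
  ultimately show ?thesis
    by (simp add: contract_marked_def marked_metric_graphs_def F_def[symmetric] Let_def)
qed

section \<open>Distances in the theta graph with edge lengths 1, 1 and a\<close>

definition theta :: mgraph where
  "theta = \<lparr>verts = {0, 1}, edges = {0, 1, 2}, tail = \<lambda>_. 0, head = \<lambda>_. 1\<rparr>"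

text \<open>Restricted to the edges, as are the points of a product topology.\<close>

definition lens :: "real \<Rightarrow> nat \<Rightarrow> real" where
  "lens a = (\<lambda>e\<in>{0, 1, 2}. if e = 2 then a else 1)"

lemma theta_simps [simp]:
  "verts theta = {0, 1}" "edges theta = {0, 1, 2}" "tail theta e = 0" "head theta e = 1"
  by (simp_all add: theta_def)

lemma lens_simps [simp]: "lens a 0 = 1" "lens a (Suc 0) = 1" "lens a 2 = a"
  by (simp_all add: lens_def)

lemma theta_graph_theta: "theta_graph theta"
  unfolding theta_graph_def by (rule exI[of _ 0], rule exI[of _ 1]) (simp add: joins_def)

lemma connected_theta: "connected_graph theta"
proof -
  have "(0, 1) \<in> adj theta {0, 1, 2}" "(1, 0) \<in> adj theta {0, 1, 2}"
    by (auto simp: adj_def joins_def)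
  then show ?thesis by (auto simp: connected_graph_def connects_def)
qed

lemma stable_theta: "stable_graph theta"
proof -
  have "connects theta ({0, 1, 2} - {e})" for e
  proof -
    have f: "(if e = 0 then 1 else 0) \<in> {0, 1, 2} - {e}" by simp
    have "(0, 1) \<in> adj theta ({0, 1, 2} - {e})" "(1, 0) \<in> adj theta ({0, 1, 2} - {e})"
      unfolding adj_def mem_Collect_eq prod.case by (rule bexI[OF _ f], simp add: joins_def)+
    then show ?thesis by (simp add: connects_def r_into_rtrancl)
  qed
  moreover have "valency theta v = 3" if "v \<in> {0, 1}" for v
  proof -
    have "{e \<in> edges theta. tail theta e = v} = (if v = 0 then {0, 1, 2} else {})"
      "{e \<in> edges theta. head theta e = v} = (if v = 1 then {0, 1, 2} else {})"
      unfolding theta_simps by auto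
    then show ?thesis using that unfolding valency_def by (elim insertE emptyE) simp_all
  qed
  ultimately show ?thesis unfolding stable_graph_def bridge_def theta_simps by (simp add: connected_theta)
qed

lemma genus_theta: "genus theta = 2"
  by (simp add: genus_def)

text \<open>The length \<open>a = 0\<close> is included: it gives the rose as a pseudometric on the theta graph.\<close>

locale theta_lengths =
  fixes a :: real
  assumes a: "0 \<le> a" "a \<le> 1"
begin

sublocale weighted_graph theta "lens a"
  by standard (use a connected_theta in auto)

text \<open>Position by arc length from vertex 0. A vertex has a position on each of the three edges.\<close>

definition located :: "point \<Rightarrow> nat \<Rightarrow> real \<Rightarrow> bool" where
  "located x e r \<longleftrightarrow> e \<in> {0, 1, 2} \<and> (\<exists>s\<in>{0..1}. x = glue theta (Inr e, s) \<and> r = lens a e * s)"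

lemma lens_bounds: "e \<in> {0, 1, 2} \<Longrightarrow> 0 \<le> lens a e \<and> a \<le> lens a e \<and> lens a e \<le> 1"
  using a by auto

lemma located_points: "located x e r \<Longrightarrow> x \<in> points theta"
  unfolding located_def using edge_in_points[of e theta] by fastforce

lemma located_exists:
  assumes "x \<in> points theta"
  obtains e r where "located x e r"
proof -
  have "\<exists>e\<in>{0, 1, 2}. \<exists>s\<in>{0..1}. x = glue theta (Inr e, s)"
    using assms unfolding points_iff
  proof (elim disjE bexE)
    fix v assume "v \<in> verts theta" "x = (Inl v, 0)"
    then have "x = glue theta (Inr 0, real v)" "real v \<in> {0..1}" by auto
    then show ?thesis by blast
  qed auto
  then show thesis using that unfolding located_def by blast
qed

lemma located_bounds: "located x e r \<Longrightarrow> 0 \<le> r \<and> r \<le> lens a e \<and> e \<in> {0, 1, 2}"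
  unfolding located_def using lens_bounds[of e] by (auto intro: mult_left_le simp: mult_left_le)

lemma located_edge: "e \<in> {0, 1, 2} \<Longrightarrow> s \<in> {0..1} \<Longrightarrow> located (glue theta (Inr e, s)) e (lens a e * s)"
  unfolding located_def by blast

lemma d_vertices:
  assumes "located x e r"
  shows "d x (Inl 0, 0) \<le> r" "d x (Inl 1, 0) \<le> lens a e - r"
proof -
  obtain s where s: "e \<in> {0, 1, 2}" "s \<in> {0..1}" "x = glue theta (Inr e, s)" "r = lens a e * s"
    using assms unfolding located_def by blast
  show "d x (Inl 0, 0) \<le> r"
    using d_edge[of e s 0] s by (simp del: glue.simps) simp
  show "d x (Inl 1, 0) \<le> lens a e - r"
    using d_edge[of e s 1] s by (simp del: glue.simps) (simp add: algebra_simps)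
qed

lemma d_upper:
  assumes "located x e r" "located y f r'"
  shows "d x y \<le> r + r'" "d x y \<le> (lens a e - r) + (lens a f - r')"
    "d x y \<le> r + a + (lens a f - r')" "d x y \<le> (lens a e - r) + a + r'"
    "e = f \<Longrightarrow> d x y \<le> \<bar>r - r'\<bar>"
proof -
  note x = located_points[OF assms(1)] and y = located_points[OF assms(2)]
  have u: "(Inl 0, 0) \<in> points theta" and v: "(Inl 1, 0) \<in> points theta"
    by (auto intro: vertex_in_points)
  have uv: "d (Inl 0, 0) (Inl 1, 0) \<le> a"
    using d_edge[of 2 0 1] by simp
  note d_vertices[OF assms(1)] d_vertices[OF assms(2)] uv
    d_triangle[OF x u y] d_triangle[OF x v y] d_triangle[OF u v y] d_triangle[OF v u y]
    d_sym[OF u y] d_sym[OF v y] d_sym[OF v u]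
  then show "d x y \<le> r + r'" "d x y \<le> (lens a e - r) + (lens a f - r')"
    "d x y \<le> r + a + (lens a f - r')" "d x y \<le> (lens a e - r) + a + r'"
    by linarith+
  show "d x y \<le> \<bar>r - r'\<bar>" if "e = f"
  proof -
    obtain s where s: "e \<in> {0, 1, 2}" "s \<in> {0..1}" "x = glue theta (Inr e, s)" "r = lens a e * s"
      using assms(1) unfolding located_def by blast
    obtain t where t: "t \<in> {0..1}" "y = glue theta (Inr e, t)" "r' = lens a e * t"
      using assms(2) unfolding located_def \<open>e = f\<close>[symmetric] by blast
    have "\<bar>r - r'\<bar> = lens a e * \<bar>s - t\<bar>"
    proof -
      have "r - r' = lens a e * (s - t)" unfolding s(4) t(3) by (simp add: right_diff_distrib)
      then show ?thesis using lens_bounds[OF s(1)] by (simp add: abs_mult)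
    qed
    then show ?thesis using d_edge[of e s t] s t by (simp del: glue.simps)
  qed
qed

text \<open>The right-hand side, as a function of \<open>y\<close>, does not stretch edges: \<open>\<alpha>\<close> and \<open>\<beta>\<close> are the
  distances from \<open>x\<close> to the two vertices, and they differ by at most \<open>a\<close>.\<close>

lemma d_lower:
  assumes x: "located x e r" and y: "located y f r'"
  defines "\<alpha> \<equiv> min r (lens a e - r + a)" and "\<beta> \<equiv> min (lens a e - r) (r + a)"
  shows "min (min (\<alpha> + r') (\<beta> + (lens a f - r'))) (if e = f then \<bar>r - r'\<bar> else 2) \<le> d x y"
proof -
  define D where "D = (\<lambda>f r'. min (min (\<alpha> + r') (\<beta> + (lens a f - r'))) (if e = f then \<bar>r - r'\<bar> else 2))"
  define h where "h = (\<lambda>(c, t). case c of Inl v \<Rightarrow> if v = (0::nat) then \<alpha> else \<beta> | Inr f \<Rightarrow> D f (lens a f * t))"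
  note e = located_bounds[OF x]
  have \<alpha>\<beta>: "0 \<le> \<alpha>" "0 \<le> \<beta>" "\<alpha> \<le> \<beta> + a" "\<beta> \<le> \<alpha> + a" "\<alpha> \<le> 1" "\<beta> \<le> 1" "\<alpha> \<le> r" "\<beta> \<le> lens a e - r"
    unfolding \<alpha>_def \<beta>_def using e lens_bounds[of e] a by (auto simp: min_def)
  have h_glue: "h (glue theta (Inr f, t)) = D f (lens a f * t)" if "f \<in> {0, 1, 2}" "t \<in> {0..1}" for f t
  proof -
    have "D f 0 = \<alpha>" "D f (lens a f) = \<beta>"
      unfolding D_def using \<alpha>\<beta> lens_bounds[OF that(1)] e by (auto simp: min_def)
    then show ?thesis by (auto simp: h_def)
  qed
  have "h y - h x \<le> d x y"
  proof (rule d_ge_nonexpansive[OF located_points[OF x] located_points[OF y]])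
    fix f s t assume f: "f \<in> edges theta" "s \<in> {0..1::real}" "t \<in> {0..1::real}"
    have "\<bar>lens a f * t - lens a f * s\<bar> = lens a f * \<bar>s - t\<bar>"
    proof -
      have "lens a f * t - lens a f * s = lens a f * (t - s)" by (simp add: right_diff_distrib)
      then show ?thesis using lens_bounds[of f] f by (simp add: abs_mult abs_minus_commute)
    qed
    moreover have "D f p - D f q \<le> \<bar>p - q\<bar>" for p q
      unfolding D_def by (auto simp: min_def)
    ultimately show "h (glue theta (Inr f, t)) - h (glue theta (Inr f, s)) \<le> lens a f * \<bar>s - t\<bar>"
      using h_glue[of f t] h_glue[of f s] f by (metis theta_simps(2))
  qed
  moreover have "h x \<le> 0"
    using x h_glue unfolding located_def by (auto simp: D_def simp del: glue.simps)
  moreover have "h y = D f r'"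
    using y h_glue unfolding located_def by (auto simp del: glue.simps)
  ultimately show ?thesis unfolding D_def by linarith
qed

text \<open>If two corners lie on edge \<open>e\<close>, the triangle is no longer than the closed walk along \<open>e\<close> and
  \<open>f\<close>: the third corner is joined to them through different vertices.\<close>

lemma perimeter_same_edge:
  assumes "located x e r" "located y e r'" "located z f r''"
  shows "d x y + d y z + d z x \<le> 2"
  using d_upper[OF assms(1,2)] d_upper[OF assms(2,3)] d_upper[OF assms(3,1)]
    located_bounds[OF assms(1)] located_bounds[OF assms(2)] located_bounds[OF assms(3)]
    lens_bounds[of e] lens_bounds[of f] by linarith

lemma perimeter_le_2_or_distinct:
  assumes "located x e r" "located y f r'" "located z g r''"
  shows "d x y + d y z + d z x \<le> 2 \<or> e \<noteq> f \<and> f \<noteq> g \<and> g \<noteq> e"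
proof -
  note pts = located_points[OF assms(1)] located_points[OF assms(2)] located_points[OF assms(3)]
  note d_sym[OF pts(1,2)] d_sym[OF pts(2,3)] d_sym[OF pts(3,1)]
  then show ?thesis
    using perimeter_same_edge[of x e r y r' z g r''] perimeter_same_edge[of y f r' z r'' x e r]
      perimeter_same_edge[of z g r'' x r y f r'] assms by fastforce
qed

lemma lens_distinct:
  "e \<in> {0, 1, 2} \<Longrightarrow> f \<in> {0, 1, 2} \<Longrightarrow> g \<in> {0, 1, 2} \<Longrightarrow> e \<noteq> f \<Longrightarrow> f \<noteq> g \<Longrightarrow> g \<noteq> e \<Longrightarrow>
    lens a e + lens a f + lens a g = 2 + a"
  by auto

lemma located_long: "s \<in> {0..1} \<Longrightarrow> e \<in> {0, 1} \<Longrightarrow> located (glue theta (Inr e, s)) e s"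
  using located_edge[of e s] by auto

lemma located_short: "s \<in> {0..1} \<Longrightarrow> located (glue theta (Inr 2, s)) 2 (a * s)"
  using located_edge[of 2 s] by auto

abbreviation mid :: "nat \<Rightarrow> point" where
  "mid e \<equiv> glue theta (Inr e, 1 / 2)"

lemma located_mid:
  "located (mid 0) 0 (1 / 2)" "located (mid 1) 1 (1 / 2)" "located (mid 2) 2 (a / 2)"
  using located_edge[of 0 "1 / 2"] located_edge[of 1 "1 / 2"] located_edge[of 2 "1 / 2"]
  by (simp_all del: glue.simps)

lemma spread_eqI:
  assumes "\<And>q. q 0 = p \<Longrightarrow> (\<And>i. q i \<in> points theta) \<Longrightarrow> (\<Sum>(i, j)\<leftarrow>ps. d (q i) (q j)) \<le> V"
    and "q 0 = p" "\<And>i. q i \<in> points theta" "V \<le> (\<Sum>(i, j)\<leftarrow>ps. d (q i) (q j))"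
  shows "spread ps theta (lens a) p = V"
  unfolding spread_def
proof (rule cSup_eq_maximum)
  have q: "q \<in> configurations theta p" using assms(2,3) by (auto simp: configurations_def)
  have le: "(\<Sum>(i, j)\<leftarrow>ps. d (q i) (q j)) \<le> V" if "q \<in> configurations theta p" for q
    using that by (intro assms(1)) (auto simp: configurations_def)
  show "V \<in> (\<lambda>q. \<Sum>(i, j)\<leftarrow>ps. d (q i) (q j)) ` configurations theta p"
    using q le[OF q] assms(4) by (intro image_eqI[of _ _ q]) auto
  show "x \<le> V" if "x \<in> (\<lambda>q. \<Sum>(i, j)\<leftarrow>ps. d (q i) (q j)) ` configurations theta p" for x
    using that le by auto
qed

section \<open>Three invariants of a marked theta graph\<close>

text \<open>Corners on three different edges can be joined through vertex 0 or through vertex 1, and the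
  two perimeters add up to twice the total length. The midpoints attain this bound.\<close>

lemma max_perimeter:
  assumes p: "p \<in> points theta"
  shows "spread [(1, 2), (2, 3), (3, 1)] theta (lens a) p = 2 + a"
proof -
  define m where "m = (\<lambda>i::nat. if i = 0 then p else if i = 1 then mid 0 else if i = 2 then mid 1 else mid 2)"
  show ?thesis
  proof (rule spread_eqI[where q = m])
  fix q :: "nat \<Rightarrow> point" assume q: "\<And>i. q i \<in> points theta"
  obtain e r where 1: "located (q 1) e r" using located_exists q by blast
  obtain f r' where 2: "located (q 2) f r'" using located_exists q by blast
  obtain g r'' where 3: "located (q 3) g r''" using located_exists q by blast
  have "d (q 1) (q 2) + d (q 2) (q 3) + d (q 3) (q 1) \<le> 2 + a"
    using perimeter_le_2_or_distinct[OF 1 2 3]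
  proof
    assume "e \<noteq> f \<and> f \<noteq> g \<and> g \<noteq> e"
    then have "lens a e + lens a f + lens a g = 2 + a"
      using located_bounds[OF 1] located_bounds[OF 2] located_bounds[OF 3] by (intro lens_distinct) auto
    then show ?thesis
      using d_upper(1,2)[OF 1 2] d_upper(1,2)[OF 2 3] d_upper(1,2)[OF 3 1] by linarith
  qed (use a in simp)
  then show "(\<Sum>(i, j)\<leftarrow>[(1, 2), (2, 3), (3, 1)]. d (q i) (q j)) \<le> 2 + a" by simp
next
    note l = located_mid
    have "1 \<le> d (mid 0) (mid 1)" using d_lower[OF l(1,2)] a by (simp del: glue.simps)
    moreover have "(1 + a) / 2 \<le> d (mid 1) (mid 2)" using d_lower[OF l(2,3)] a by (simp add: field_simps del: glue.simps)
    moreover have "(1 + a) / 2 \<le> d (mid 2) (mid 0)" using d_lower[OF l(3,1)] a by (simp add: field_simps del: glue.simps)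
    ultimately show "2 + a \<le> (\<Sum>(i, j)\<leftarrow>[(1, 2), (2, 3), (3, 1)]. d (m i) (m j))"
      by (simp del: glue.simps add: field_simps m_def)
  next
    show "m i \<in> points theta" for i
      unfolding m_def using p by (auto intro!: edge_in_points simp del: glue.simps)
  qed (simp add: m_def)
qed

lemma marked_perimeter_upper:
  assumes p: "located p e b" and y: "y \<in> points theta" and z: "z \<in> points theta"
  shows "d p y + d y z + d z p \<le> max 2 (2 * b + (2 + a - lens a e))"
proof -
  obtain f r' where 2: "located y f r'" using located_exists y by blast
  obtain g r'' where 3: "located z g r''" using located_exists z by blast
  show ?thesis
    using perimeter_le_2_or_distinct[OF p 2 3]
  proof
    assume "e \<noteq> f \<and> f \<noteq> g \<and> g \<noteq> e"
    then have "lens a e + lens a f + lens a g = 2 + a"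
      using located_bounds[OF p] located_bounds[OF 2] located_bounds[OF 3] by (intro lens_distinct) auto
    then show ?thesis
      using d_upper(1,2)[OF p 2] d_upper(1,2)[OF 2 3] d_upper(1,2)[OF 3 p] by linarith
  qed simp
qed

text \<open>A farthest point lies on edge 1. The bound 1 comes from the cycle of edges 0 and 1, the other
  bound from going to the nearest vertex first and then around the cycle of edges 1 and 2.\<close>

lemma eccentricity_long:
  assumes s: "s \<in> {0..1/2}"
  shows "spread [(0, 1)] theta (lens a) (glue theta (Inr 0, s)) = min 1 (s + (1 + a) / 2)"
proof -
  define t where "t = min ((1 + a) / 2) (1 - s)"
  have t: "t \<in> {0..1}" "t \<le> 1 - s" "t \<le> (1 + a) / 2" using s a by (auto simp: t_def min_def)
  have p: "located (glue theta (Inr 0, s)) 0 s" and x: "located (glue theta (Inr 1, t)) 1 t"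
    using s t by (auto intro!: located_long simp del: glue.simps)
  show ?thesis
  proof (rule spread_eqI[where q = "\<lambda>i::nat. if i = 0 then glue theta (Inr 0, s) else glue theta (Inr 1, t)"])
    fix q :: "nat \<Rightarrow> point" assume q0: "q 0 = glue theta (Inr 0, s)" and q: "\<And>i. q i \<in> points theta"
    obtain e r where 1: "located (q 1) e r" using located_exists q by blast
    note up = d_upper[OF p 1] and r = located_bounds[OF 1]
    then consider "e = 0" | "e = 1" | "e = 2" by blast
    then have "d (glue theta (Inr 0, s)) (q 1) \<le> min 1 (s + (1 + a) / 2)"
    proof cases
      case 1
      then show ?thesis using up r s a by (auto simp del: glue.simps simp: field_simps abs_if split: if_splits)
    next
      case 2
      then show ?thesis using up r s a by (auto simp del: glue.simps simp: field_simps)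
    next
      case 3
      then show ?thesis using up r s a by (auto simp del: glue.simps simp: field_simps)
    qed
    then show "(\<Sum>(i, j)\<leftarrow>[(0, 1)]. d (q i) (q j)) \<le> min 1 (s + (1 + a) / 2)"
      using q0 by (simp del: glue.simps)
  next
    have "min 1 (s + (1 + a) / 2) \<le> s + t" by (auto simp: t_def)
    moreover have "s + t \<le> d (glue theta (Inr 0, s)) (glue theta (Inr 1, t))"
      using d_lower[OF p x] s t a by (auto simp: min_def field_simps simp del: glue.simps split: if_splits)
    ultimately show "min 1 (s + (1 + a) / 2) \<le> (\<Sum>(i, j)\<leftarrow>[(0::nat, 1::nat)].
        d (if i = 0 then glue theta (Inr 0, s) else glue theta (Inr 1, t))
          (if j = 0 then glue theta (Inr 0, s) else glue theta (Inr 1, t)))"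
      by (simp del: glue.simps)
  qed (use located_points[OF p] located_points[OF x] in \<open>auto simp del: glue.simps\<close>)
qed

lemma eccentricity_short:
  assumes s: "s \<in> {0..1}"
  shows "spread [(0, 1)] theta (lens a) (glue theta (Inr 2, s)) \<le> (1 + a) / 2"
  unfolding spread_def
proof (rule cSUP_least)
  have p: "located (glue theta (Inr 2, s)) 2 (a * s)" by (rule located_short[OF s])
  show "configurations theta (glue theta (Inr 2, s)) \<noteq> {}"
    by (rule configurations_nonempty[OF located_points[OF p]])
  fix q assume "q \<in> configurations theta (glue theta (Inr 2, s))"
  then have q: "q 0 = glue theta (Inr 2, s)" "q 1 \<in> points theta" by (auto simp: configurations_def)
  obtain e r where 1: "located (q 1) e r" using located_exists q by blast
  note up = d_upper[OF p 1] and r = located_bounds[OF 1] and b = located_bounds[OF p]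
  then consider "e = 0 \<or> e = 1" | "e = 2" by blast
  then have "d (glue theta (Inr 2, s)) (q 1) \<le> (1 + a) / 2"
  proof cases
    case 1
    then have "lens a e = 1" by auto
    then show ?thesis using up(1,2) by (simp add: field_simps del: glue.simps)
  next
    case 2
    then have "d (glue theta (Inr 2, s)) (q 1) \<le> a" using up(5) r b by (auto simp del: glue.simps)
    then show ?thesis using a by (simp add: field_simps del: glue.simps)
  qed
  then show "(\<Sum>(i, j)\<leftarrow>[(0, 1)]. d (q i) (q j)) \<le> (1 + a) / 2"
    using q by (simp del: glue.simps)
qed

lemma marked_perimeter_long:
  assumes s: "s \<in> {0..1/2}"
  shows "spread [(0, 1), (1, 2), (2, 0)] theta (lens a) (glue theta (Inr 0, s)) = max 2 (2 * s + 1 + a)"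
proof -
  let ?p = "glue theta (Inr 0, s)"
  have p: "located ?p 0 s" using s by (auto intro!: located_long simp del: glue.simps)
  have upper: "d ?p y + d y z + d z ?p \<le> max 2 (2 * s + 1 + a)"
    if "y \<in> points theta" "z \<in> points theta" for y z
    using marked_perimeter_upper[OF p that] by (simp add: algebra_simps del: glue.simps)
  \<comment> \<open>The first triangle goes around the cycle of length 2, the second meets all three edges.\<close>
  define y z where "y = (if 2 * s + 1 + a \<le> 2 then glue theta (Inr 0, s + 1 / 2) else mid 1)"
    and "z = (if 2 * s + 1 + a \<le> 2 then mid 1 else mid 2)"
  note m = located_mid(2,3)
  have y': "located (glue theta (Inr 0, s + 1 / 2)) 0 (s + 1 / 2)"
    using s by (auto intro!: located_long simp del: glue.simps)
  have pts: "y \<in> points theta" "z \<in> points theta"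
    unfolding y_def z_def using located_points m y' by auto
  have lower: "max 2 (2 * s + 1 + a) \<le> d ?p y + d y z + d z ?p"
  proof (cases "2 * s + 1 + a \<le> 2")
    case True
    have "1 / 2 \<le> d ?p (glue theta (Inr 0, s + 1 / 2))"
      using d_lower[OF p y'] s a by (auto simp: min_def simp del: glue.simps split: if_splits)
    moreover have "1 - s \<le> d (glue theta (Inr 0, s + 1 / 2)) (mid 1)"
      using d_lower[OF y' m(1)] s a by (auto simp: min_def simp del: glue.simps split: if_splits)
    moreover have "s + 1 / 2 \<le> d (mid 1) ?p"
      using d_lower[OF m(1) p] s a by (auto simp: min_def simp del: glue.simps split: if_splits)
    ultimately show ?thesis using True by (simp add: y_def z_def del: glue.simps)
  next
    case False
    have "s + 1 / 2 \<le> d ?p (mid 1)"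
      using d_lower[OF p m(1)] s a by (auto simp: min_def simp del: glue.simps split: if_splits)
    moreover have "(1 + a) / 2 \<le> d (mid 1) (mid 2)"
      using d_lower[OF m] s a by (auto simp: min_def field_simps simp del: glue.simps split: if_splits)
    moreover have "s + a / 2 \<le> d (mid 2) ?p"
      using d_lower[OF m(2) p] s a by (auto simp: min_def field_simps simp del: glue.simps split: if_splits)
    ultimately show ?thesis using False by (simp add: y_def z_def field_simps del: glue.simps)
  qed
  show ?thesis
    by (rule spread_eqI[where q = "\<lambda>i. if i = 0 then ?p else if i = 1 then y else z"])
      (use upper lower pts located_points[OF p] in \<open>auto simp del: glue.simps simp: add.assoc\<close>)
qed

lemma marked_perimeter_short:
  assumes s: "s \<in> {0..1/2}"
  shows "spread [(0, 1), (1, 2), (2, 0)] theta (lens a) (glue theta (Inr 2, s)) = 2 + 2 * (a * s)"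
proof -
  let ?p = "glue theta (Inr 2, s)"
  have p: "located ?p 2 (a * s)" using s by (auto intro!: located_short simp del: glue.simps)
  have as: "0 \<le> a * s" "a * s \<le> a / 2"
    using s a mult_left_mono[of s "1 / 2" a] by auto
  have upper: "d ?p y + d y z + d z ?p \<le> 2 + 2 * (a * s)"
    if "y \<in> points theta" "z \<in> points theta" for y z
    using marked_perimeter_upper[OF p that] as by (simp del: glue.simps)
  note m = located_mid(1,2)
  have "a * s + 1 / 2 \<le> d ?p (mid 0)"
    using d_lower[OF p m(1)] as a by (auto simp: min_def simp del: glue.simps split: if_splits)
  moreover have "1 \<le> d (mid 0) (mid 1)"
    using d_lower[OF m] a by (auto simp: min_def simp del: glue.simps split: if_splits)
  moreover have "a * s + 1 / 2 \<le> d (mid 1) ?p"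
    using d_lower[OF m(2) p] as a by (auto simp: min_def simp del: glue.simps split: if_splits)
  ultimately have lower: "2 + 2 * (a * s) \<le> d ?p (mid 0) + d (mid 0) (mid 1) + d (mid 1) ?p"
    by linarith
  show ?thesis
    by (rule spread_eqI[where q = "\<lambda>i. if i = 0 then ?p else if i = 1 then mid 0 else mid 1"])
      (use upper lower located_points[OF p] located_points[OF m(1)] located_points[OF m(2)] in
        \<open>auto simp del: glue.simps simp: add.assoc\<close>)
qed

end

section \<open>A model of the space in coordinates\<close>

definition parameters :: "(real \<times> real) set" where
  "parameters = {0..1} \<times> {0..1/2}"

text \<open>For the marking at relative position \<open>s\<close> on edge 0 or on edge 2 of the theta graph: the length
  \<open>a\<close> of edge 2, the distance from the marking to the nearest vertex, and a third coordinate
  that tells edge 2 from the edges of length 1, except where the two cases agree: at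
  \<open>a = 1\<close>, where all edges are alike, and at the vertices.\<close>

definition coord :: "nat \<Rightarrow> real \<times> real \<Rightarrow> real \<times> real \<times> real" where
  "coord k = (\<lambda>(a, s). if k = 0 then (a, s, 0) else (a, a * s, a * s * (1 - a)))"

lemma coord_short_iff:
  "z \<in> coord 2 ` parameters \<longleftrightarrow> (\<exists>a\<in>{0..1}. \<exists>b\<in>{0..a / 2}. z = (a, b, b * (1 - a)))"
proof
  assume "z \<in> coord 2 ` parameters"
  then obtain a s where "a \<in> {0..1}" "s \<in> {0..1/2}" "z = coord 2 (a, s)"
    by (auto simp: parameters_def)
  then show "\<exists>a\<in>{0..1}. \<exists>b\<in>{0..a / 2}. z = (a, b, b * (1 - a))"
    using mult_left_mono[of s "1 / 2" a]
    by (intro bexI[of _ a] bexI[of _ "a * s"]) (auto simp: coord_def)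
next
  assume "\<exists>a\<in>{0..1}. \<exists>b\<in>{0..a / 2}. z = (a, b, b * (1 - a))"
  then obtain a b where ab: "a \<in> {0..1}" "b \<in> {0..a / 2}" "z = (a, b, b * (1 - a))" by blast
  have "(a, b / a) \<in> parameters"
    using ab by (cases "a = 0") (auto simp: parameters_def field_simps)
  moreover have "z = coord 2 (a, b / a)" using ab by (auto simp: coord_def)
  ultimately show "z \<in> coord 2 ` parameters" by blast
qed

lemma continuous_on_coord: "continuous_on A (coord k)"
  unfolding coord_def case_prod_unfold
  by (cases "k = 0") (auto intro!: continuous_intros)

lemma compact_parameters: "compact parameters"
  unfolding parameters_def by (intro compact_Times compact_Icc)

text \<open>The homotopy slides the marking to the nearest vertex while edge 2 grows to length 1. At time
  \<open>u\<close> both the distance \<open>b\<close> to the vertex and \<open>1 - a\<close> are multiplied by \<open>1 - u\<close>, so the third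
  coordinate, which is 0 or \<open>b * (1 - a)\<close>, is multiplied by the square of it, and the motion
  respects both pieces of the model.\<close>

lemma contractible_model: "contractible (coord 0 ` parameters \<union> coord 2 ` parameters)" (is "contractible ?S")
proof -
  define h :: "real \<times> real \<times> real \<times> real \<Rightarrow> real \<times> real \<times> real"
    where "h = (\<lambda>(u, a, b, c). (1 - (1 - u) * (1 - a), (1 - u) * b, (1 - u)\<^sup>2 * c))"
  have "continuous_on ({0..1} \<times> ?S) h"
    unfolding h_def case_prod_unfold by (intro continuous_intros)
  moreover have "h (u, z) \<in> ?S" if u: "u \<in> {0..1}" and z: "z \<in> ?S" for u z
  proof -
    have a': "1 - (1 - u) * (1 - a) \<in> {0..1}" if "a \<in> {0..1}" for a
      using u that mult_mono[of "1 - u" 1 "1 - a" 1] by auto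
    from z show ?thesis
    proof
      assume "z \<in> coord 0 ` parameters"
      then obtain a s where as: "a \<in> {0..1}" "s \<in> {0..1/2}" "z = (a, s, 0)"
        by (auto simp: parameters_def coord_def)
      have "(1 - u) * s \<le> 1 * (1 / 2)" using u as by (intro mult_mono) auto
      then have "(1 - (1 - u) * (1 - a), (1 - u) * s) \<in> parameters"
        using a'[OF as(1)] as u by (auto simp: parameters_def)
      moreover have "h (u, z) = coord 0 (1 - (1 - u) * (1 - a), (1 - u) * s)"
        by (simp add: h_def coord_def as(3))
      ultimately show ?thesis by blast
    next
      assume "z \<in> coord 2 ` parameters"
      then obtain a b where ab: "a \<in> {0..1}" "b \<in> {0..a / 2}" "z = (a, b, b * (1 - a))"
        unfolding coord_short_iff by blast
      have "(1 - u) * b \<le> (1 - u) * (a / 2)" using u ab by (intro mult_left_mono) auto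
      then have "(1 - u) * b \<in> {0..(1 - (1 - u) * (1 - a)) / 2}"
      proof -
        have "1 - (1 - u) * (1 - a) = u + (1 - u) * a" by (simp add: algebra_simps)
        moreover have "0 \<le> (1 - u) * b" using u ab by (intro mult_nonneg_nonneg) auto
        ultimately show ?thesis using \<open>(1 - u) * b \<le> (1 - u) * (a / 2)\<close> u by simp
      qed
      moreover have "h (u, z) = (1 - (1 - u) * (1 - a), (1 - u) * b,
          ((1 - u) * b) * (1 - (1 - (1 - u) * (1 - a))))"
        by (simp add: h_def ab(3) power2_eq_square)
      ultimately have "h (u, z) \<in> coord 2 ` parameters"
        unfolding coord_short_iff using a'[OF ab(1)] by blast
      then show ?thesis by blast
    qed
  qed
  then have "h \<in> {0..1} \<times> ?S \<rightarrow> ?S" by (intro Pi_I, elim SigmaE) blast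
  ultimately have "continuous_map (prod_topology (top_of_set {0..1}) (top_of_set ?S)) (top_of_set ?S) h"
    by simp
  then have "homotopic_with_canon (\<lambda>x. True) ?S ?S id (\<lambda>x. (1, 0, 0))"
    unfolding homotopic_with_def by (intro exI[of _ h]) (auto simp: h_def)
  then show ?thesis unfolding contractible_def by blast
qed

text \<open>A Hausdorff space covered by finitely many continuous images of a compact set is determined
  by the identifications made: closed sets of the model are the unions of images of compact sets.\<close>

lemma homeomorphic_if_same_fibres:
  fixes g :: "'k \<Rightarrow> 'a::t2_space \<Rightarrow> 'b::t2_space"
  assumes Q: "compact Q" and K: "finite K"
    and g: "\<And>k. k \<in> K \<Longrightarrow> continuous_on Q (g k)"
    and c: "\<And>k. k \<in> K \<Longrightarrow> continuous_map (top_of_set Q) X (c k)"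
    and surj: "topspace X = (\<Union>k\<in>K. c k ` Q)" and X: "Hausdorff_space X"
    and fibres: "\<And>j k q r. j \<in> K \<Longrightarrow> k \<in> K \<Longrightarrow> q \<in> Q \<Longrightarrow> r \<in> Q \<Longrightarrow> c j q = c k r \<longleftrightarrow> g j q = g k r"
  shows "top_of_set (\<Union>k\<in>K. g k ` Q) homeomorphic_space X"
proof -
  let ?S = "\<Union>k\<in>K. g k ` Q"
  have "\<forall>z\<in>?S. \<exists>x. \<exists>k\<in>K. \<exists>q\<in>Q. z = g k q \<and> x = c k q" by blast
  then obtain f where f: "\<And>z. z \<in> ?S \<Longrightarrow> \<exists>k\<in>K. \<exists>q\<in>Q. z = g k q \<and> f z = c k q" by metis
  have fg: "f (g k q) = c k q" if kq: "k \<in> K" "q \<in> Q" for k q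
  proof -
    obtain j r where j: "j \<in> K" "r \<in> Q" "g k q = g j r" "f (g k q) = c j r"
      using f[of "g k q"] kq by blast
    then show ?thesis using fibres[OF kq(1) j(1) kq(2) j(2)] by simp
  qed
  have "compact ?S" using K Q g by (intro compact_UN compact_continuous_image) auto
  have "continuous_map (top_of_set ?S) X f"
    unfolding continuous_map_closedin
  proof (intro conjI allI impI)
    show "f \<in> topspace (top_of_set ?S) \<rightarrow> topspace X" using fg surj by auto
    fix C assume C: "closedin X C"
    have eq: "{z \<in> topspace (top_of_set ?S). f z \<in> C} = (\<Union>k\<in>K. g k ` {q \<in> Q. c k q \<in> C})"
      using fg by auto
    have "compact (g k ` {q \<in> Q. c k q \<in> C})" if k: "k \<in> K" for k
    proof (rule compact_continuous_image)
      have "closedin (top_of_set Q) {q \<in> Q. c k q \<in> C}"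
        using closedin_continuous_map_preimage[OF c[OF k] C] by simp
      then show "compact {q \<in> Q. c k q \<in> C}" using Q closedin_compact by blast
      show "continuous_on {q \<in> Q. c k q \<in> C} (g k)"
        by (rule continuous_on_subset[OF g[OF k]]) auto
    qed
    then have "compact (\<Union>k\<in>K. g k ` {q \<in> Q. c k q \<in> C})" using K by (intro compact_UN) auto
    then show "closedin (top_of_set ?S) {z \<in> topspace (top_of_set ?S). f z \<in> C}"
      unfolding eq by (intro closed_subset compact_imp_closed) auto
  qed
  moreover have "f ` topspace (top_of_set ?S) = topspace X"
    using fg surj by (auto simp: image_UN image_image)
  moreover have "inj_on f (topspace (top_of_set ?S))"
  proof (rule inj_onI)
    fix y z assume "y \<in> topspace (top_of_set ?S)" "z \<in> topspace (top_of_set ?S)" and eq: "f y = f z"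
    then obtain j q k r where "j \<in> K" "q \<in> Q" "y = g j q" "k \<in> K" "r \<in> Q" "z = g k r" by auto
    then show "y = z" using fibres eq fg by metis
  qed
  ultimately have "homeomorphic_map (top_of_set ?S) X f"
    using \<open>compact ?S\<close> X by (intro continuous_imp_homeomorphic_map) (auto simp: compact_space_subtopology)
  then show ?thesis by (rule homeomorphic_map_imp_homeomorphic_space)
qed

section \<open>Parametrization of the space\<close>

definition mark :: "nat \<Rightarrow> real \<Rightarrow> nat \<Rightarrow> point" where
  "mark k s = (\<lambda>i\<in>{1..1}. glue theta (Inr k, s))"

text \<open>For \<open>a = 0\<close> edge 2 is contracted, and the graph is the rose with two loops of length 1.\<close>

definition param :: "nat \<Rightarrow> real \<times> real \<Rightarrow> marked_graph set" where
  "param k = (\<lambda>(a, s). iso_class 2 1 (contract_marked 1 (theta, lens a, mark k s)))"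

lemma mark_in_points: "k \<in> {0, 2} \<Longrightarrow> s \<in> {0..1} \<Longrightarrow> mark k s \<in> {1..1} \<rightarrow>\<^sub>E points theta"
  unfolding mark_def using edge_in_points[of k theta s] by (auto simp del: glue.simps)

lemma forest_if_single_edge:
  assumes "F \<subseteq> {e}" "F \<subseteq> edges G" "e \<in> F \<Longrightarrow> tail G e \<noteq> head G e"
  shows "is_forest G F"
proof -
  have False if c: "is_cycle G vs es" "set es \<subseteq> F" for vs es
  proof -
    have es: "es \<noteq> []" "distinct es" "length vs = length es"
      and ends: "joins G (es ! 0) (vs ! 0) (vs ! (Suc 0 mod length es))"
      using c by (auto simp: is_cycle_def)
    have "set es \<subseteq> {e}" using c(2) assms(1) by blast
    then have "card (set es) \<le> card {e}" by (intro card_mono) auto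
    then have "length es = 1" using es by (cases es) (auto simp: distinct_card)
    moreover from this have "es ! 0 \<in> set es" by simp
    moreover from this have "es ! 0 = e" "e \<in> F" using \<open>set es \<subseteq> {e}\<close> c(2) by auto
    ultimately show False using ends assms(3) by (auto simp: joins_def)
  qed
  then show ?thesis using assms(2) unfolding is_forest_def by blast
qed

lemma zero_edges_lens: "zero_edges theta (lens a) = (if a = 0 then {2} else {})"
  by (auto simp: zero_edges_def lens_def)

lemma lens_in_length_space:
  assumes "a \<in> {0..1}"
  shows "lens a \<in> topspace (length_space theta)"
proof -
  have "is_forest theta (zero_edges theta (lens a))"
    by (rule forest_if_single_edge[of _ 2]) (auto simp: zero_edges_lens)
  then show ?thesis using assms by (auto simp: topspace_length_space lens_def)
qed

lemma continuous_map_param: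
  assumes k: "k \<in> {0, 2}"
  shows "continuous_map (top_of_set parameters) (TM_space 2 1) (param k)"
proof -
  let ?P = "product_topology (\<lambda>i. realization theta) {1..1::nat}"
  let ?Y = "\<lambda>G. prod_topology (length_space G) (product_topology (\<lambda>i. realization G) {1..1::nat})"
  let ?I = "{G. stable_graph G \<and> genus G = int 2}"
  have "continuous_map (top_of_set parameters) (length_space theta) (\<lambda>q. lens (fst q))"
    unfolding length_space_def
  proof (rule continuous_map_into_subtopology)
    show "continuous_map (top_of_set parameters) (product_topology (\<lambda>e. top_of_set {0..}) (edges theta))
        (\<lambda>q. lens (fst q))"
      unfolding continuous_map_componentwise
      by (auto simp: parameters_def lens_def extensional_def intro!: continuous_intros)
    show "(\<lambda>q. lens (fst q)) \<in> topspace (top_of_set parameters) \<rightarrow> {l. is_forest theta (zero_edges theta l)}"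
      using lens_in_length_space by (auto simp: parameters_def topspace_length_space)
  qed
  moreover have "continuous_map (top_of_set parameters) ?P (\<lambda>q. mark k (snd q))"
    unfolding continuous_map_componentwise
  proof (intro conjI ballI)
    show "(\<lambda>q. mark k (snd q)) ` topspace (top_of_set parameters) \<subseteq> extensional {1..1}"
      by (auto simp: mark_def)
    fix i :: nat assume i: "i \<in> {1..1}"
    have "continuous_map (top_of_set {0..1}) (cells theta) (\<lambda>s. (Inr k, s))"
      unfolding cells_def
      using continuous_map_component_injection[of "Inr k" "verts theta <+> edges theta"
          "case_sum (\<lambda>v. top_of_set {0}) (\<lambda>e. top_of_set {0..1::real})"] k by auto
    moreover have "continuous_map (top_of_set parameters) (top_of_set {0..1}) snd"
      by (auto simp: parameters_def intro!: continuous_intros)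
    ultimately have "continuous_map (top_of_set parameters) (realization theta)
        (glue theta \<circ> ((\<lambda>s. (Inr k, s)) \<circ> snd))"
      unfolding realization_def
      by (intro continuous_map_compose[OF _ quotient_imp_continuous_map[OF quotient_map_quotient_topology]]
          continuous_map_compose)
    then show "continuous_map (top_of_set parameters) (realization theta) (\<lambda>q. mark k (snd q) i)"
      using i by (simp add: mark_def o_def del: glue.simps)
  qed
  ultimately have "continuous_map (top_of_set parameters) (?Y theta) (\<lambda>q. (lens (fst q), mark k (snd q)))"
    by (simp add: continuous_map_pairwise o_def)
  moreover have "continuous_map (?Y theta) (sum_topology ?Y ?I) (\<lambda>x. (theta, x))"
    by (rule continuous_map_component_injection) (simp add: stable_theta genus_theta)
  moreover have "continuous_map (sum_topology ?Y ?I) (TM_space 2 1) (\<lambda>t. iso_class 2 1 (contract_marked 1 t))"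
    unfolding TM_space_def by (rule quotient_imp_continuous_map[OF quotient_map_quotient_topology])
  ultimately have "continuous_map (top_of_set parameters) (TM_space 2 1)
      ((\<lambda>t. iso_class 2 1 (contract_marked 1 t)) \<circ> ((\<lambda>x. (theta, x)) \<circ> (\<lambda>q. (lens (fst q), mark k (snd q)))))"
    by (intro continuous_map_compose)
  then show ?thesis by (simp add: param_def o_def case_prod_unfold)
qed

lemma param_marked:
  assumes "k \<in> {0, 2}" "(a, s) \<in> parameters"
  shows "contract_marked 1 (theta, lens a, mark k s) \<in> marked_metric_graphs 2 1"
  using assms by (intro contract_marked_in_marked_metric_graphs lens_in_length_space mark_in_points)
    (auto simp: stable_theta genus_theta parameters_def)

lemma param_in_X_space:
  assumes "k \<in> {0, 2}" "q \<in> parameters"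
  shows "param k q \<in> topspace (X_space 2 1)"
proof -
  obtain a s where q: "q = (a, s)" by (cases q)
  have a: "0 \<le> a" "a \<le> 1" using assms q by (auto simp: parameters_def)
  define F where "F = zero_edges theta (lens a)"
  define G l p where "G = contract theta F" and "l = restrict (lens a) (edges theta - F)"
    and "p = (\<lambda>i\<in>{1..1}. contract_point theta F (mark k s i))"
  have t: "contract_marked 1 (theta, lens a, mark k s) = (G, l, p)"
    by (simp add: contract_marked_def Let_def F_def G_def l_def p_def)
  have E: "edges G = {0, 1, 2} - F" by (simp add: G_def contract_def)
  have F: "F = (if a = 0 then {2} else {})" by (simp add: F_def zero_edges_lens)
  have "l e \<le> 1" if "e \<in> edges G" for e
    using that a unfolding E l_def by auto
  moreover have "0 \<in> edges G" "l 0 = 1" using F by (auto simp: E l_def)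
  ultimately have "Max (l ` edges G) = 1"
    by (intro Max_eqI) (auto simp: E intro!: image_eqI[of _ _ 0])
  moreover have "is_forest G {e \<in> edges G. l e < 1}"
  proof (rule forest_if_single_edge[of _ 2])
    show "{e \<in> edges G. l e < 1} \<subseteq> {2}" by (auto simp: E l_def)
    show "tail G 2 \<noteq> head G 2" if "2 \<in> {e \<in> edges G. l e < 1}"
    proof -
      have "F = {}" using that F E by (auto split: if_splits)
      then show ?thesis by (simp add: G_def contract_empty)
    qed
  qed auto
  moreover have "(G, l, p) \<in> marked_metric_graphs 2 1"
    using param_marked assms unfolding q t[symmetric] by blast
  ultimately have "param k q \<in> {iso_class 2 1 (G, l, p) | G l p.
          (G, l, p) \<in> marked_metric_graphs 2 1 \<and> Max (l ` edges G) = 1 \<and>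
          is_forest G {e \<in> edges G. l e < 1}}"
    unfolding param_def q prod.case t by blast
  moreover have "param k q \<in> topspace (TM_space 2 1)"
    using continuous_map_image_subset_topspace[OF continuous_map_param[OF assms(1)]] assms(2) by auto
  ultimately show ?thesis by (simp add: X_space_def)
qed

section \<open>The identifications\<close>

lemma class_spread_param:
  assumes "k \<in> {0, 2}" "(a, s) \<in> parameters"
  shows "class_spread ps 1 (param k (a, s)) = spread ps theta (lens a) (glue theta (Inr k, s))"
proof -
  have as: "a \<in> {0..1}" "s \<in> {0..1}" using assms by (auto simp: parameters_def)
  obtain H m q where t: "contract_marked 1 (theta, lens a, mark k s) = (H, m, q)" by (metis surj_pair)
  have "class_spread ps 1 (param k (a, s)) = spread ps H m (q 1)"
    unfolding param_def prod.case t
    by (rule class_spread_iso_class[OF param_marked[OF assms, unfolded t]]) simp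
  also have "\<dots> = spread ps theta (lens a) (mark k s 1)"
    using mark_in_points[OF assms(1) as(2)]
    by (intro spread_contract_marked[OF connected_theta lens_in_length_space[OF as(1)] _ _ t]) auto
  finally show ?thesis by (simp add: mark_def del: glue.simps)
qed

text \<open>Both the distance to the farthest point and the longest perimeter of a triangle through the
  marking saturate, on an edge of length 1, but in complementary ranges: each is constant where the
  other one determines \<open>s\<close>.\<close>

lemma coord_eq_if_class_spread_eq:
  assumes j: "j \<in> {0, 2}" "(a, s) \<in> parameters" and k: "k \<in> {0, 2}" "(b, t) \<in> parameters"
    and eq: "\<And>ps. class_spread ps 1 (param j (a, s)) = class_spread ps 1 (param k (b, t))"
  shows "coord j (a, s) = coord k (b, t)"
proof -
  have as: "a \<in> {0..1}" "s \<in> {0..1/2}" and bt: "b \<in> {0..1}" "t \<in> {0..1/2}"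
    using j k by (auto simp: parameters_def)
  interpret A: theta_lengths a by standard (use as in auto)
  interpret B: theta_lengths b by standard (use bt in auto)
  have eq': "spread ps theta (lens a) (glue theta (Inr j, s)) = spread ps theta (lens b) (glue theta (Inr k, t))" for ps
    using eq[of ps] unfolding class_spread_param[OF j] class_spread_param[OF k] .
  have "2 + a = 2 + b"
    using eq'[of "[(1, 2), (2, 3), (3, 1)]"] j(1) k(1) as(2) bt(2)
    by (subst (asm) A.max_perimeter, force intro: edge_in_points simp del: glue.simps,
        subst (asm) B.max_perimeter, force intro: edge_in_points simp del: glue.simps, simp)
  then have ab: "b = a" by simp
  have t: "t \<in> {0..1}" "s \<in> {0..1}" using as bt by auto
  note E = eq'[of "[(0, 1)]", unfolded ab] and P = eq'[of "[(0, 1), (1, 2), (2, 0)]", unfolded ab]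
  have mixed: "a * y = x \<and> x * (1 - a) = 0"
    if xy: "x \<in> {0..1/2}" "y \<in> {0..1/2}"
      and E: "spread [(0, 1)] theta (lens a) (glue theta (Inr 0, x)) =
        spread [(0, 1)] theta (lens a) (glue theta (Inr 2, y))"
      and P: "spread [(0, 1), (1, 2), (2, 0)] theta (lens a) (glue theta (Inr 0, x)) =
        spread [(0, 1), (1, 2), (2, 0)] theta (lens a) (glue theta (Inr 2, y))" for x y
  proof -
    have E': "min 1 (x + (1 + a) / 2) \<le> (1 + a) / 2"
      using A.eccentricity_short[of y] xy unfolding E[symmetric] A.eccentricity_long[OF xy(1)] by auto
    have P': "max 2 (2 * x + 1 + a) = 2 + 2 * (a * y)"
      using P unfolding A.marked_perimeter_long[OF xy(1)] A.marked_perimeter_short[OF xy(2)] .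
    have "a = 1 \<or> x = 0"
    proof (cases "1 \<le> x + (1 + a) / 2")
      case True
      then have "1 \<le> (1 + a) / 2" using E' by simp
      then show ?thesis using as by simp
    next
      case False
      then have "x \<le> 0" using E' by linarith
      then show ?thesis using xy by simp
    qed
    then show ?thesis
    proof
      assume "a = 1"
      then show ?thesis using P' xy by simp
    next
      assume "x = 0"
      then show ?thesis using P' as by simp
    qed
  qed
  consider "j = 0" "k = 0" | "j = 2" "k = 2" | "j = 0" "k = 2" | "j = 2" "k = 0"
    using j(1) k(1) by blast
  then show ?thesis
  proof cases
    case 1
    have "min 1 (s + (1 + a) / 2) = min 1 (t + (1 + a) / 2)"
      using E unfolding 1 A.eccentricity_long[OF as(2)] A.eccentricity_long[OF bt(2)] .
    moreover have "max 2 (2 * s + 1 + a) = max 2 (2 * t + 1 + a)"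
      using P unfolding 1 A.marked_perimeter_long[OF as(2)] A.marked_perimeter_long[OF bt(2)] .
    ultimately have "s = t" by (auto simp: min_def max_def field_simps split: if_splits)
    then show ?thesis using 1 ab by simp
  next
    case 2
    have "2 + 2 * (a * s) = 2 + 2 * (a * t)"
      using P unfolding 2 A.marked_perimeter_short[OF as(2)] A.marked_perimeter_short[OF bt(2)] .
    then have "a * s = a * t" by simp
    moreover have "coord 2 (a, x) = (a, a * x, a * x * (1 - a))" for x by (simp add: coord_def)
    ultimately show ?thesis unfolding 2 ab by (simp only:)
  next
    case 3
    have "a * t = s \<and> s * (1 - a) = 0"
      using mixed[OF as(2) bt(2)] E P unfolding 3 by blast
    then show ?thesis using 3 ab by (simp add: coord_def)
  next
    case 4
    have "a * s = t \<and> t * (1 - a) = 0"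
      using mixed[OF bt(2) as(2)] E[symmetric] P[symmetric] unfolding 4 by blast
    then show ?thesis using 4 ab by (simp add: coord_def)
  qed
qed

lemma contract_marked_mark:
  assumes "a \<noteq> 0"
  shows "contract_marked 1 (theta, lens a, mark k s) = (theta, lens a, mark k s)"
proof -
  have "restrict (lens a) (edges theta) = lens a" by (auto simp: lens_def)
  then show ?thesis
    using assms
    by (simp add: contract_marked_def zero_edges_lens contract_empty contract_point_empty mark_def del: theta_simps)
qed

text \<open>On the contracted edge all relative positions become the same point, the vertex of the rose.\<close>

lemma param_zero_length: "param 2 (0, s) = param 0 (0, 0)"
proof -
  have "contract_point theta {2} (glue theta (Inr 2, s)) = contract_point theta {2} (glue theta (Inr 0, 0))"
    unfolding contract_glue by (simp add: contract_def)
  then show ?thesis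
    by (simp add: param_def contract_marked_def zero_edges_lens mark_def del: glue.simps cong: restrict_cong)
qed

lemma param_vertex: "param 2 (a, 0) = param 0 (a, 0)"
  by (simp add: param_def mark_def)

lemma weighted_theta: "a \<in> {0..1} \<Longrightarrow> weighted_graph theta (lens a)"
  by (rule weighted_graph.intro[OF connected_theta]) (auto simp: lens_def)

text \<open>When all lengths are 1, exchanging edges 0 and 2 is an automorphism.\<close>

lemma param_equal_lengths:
  assumes "s \<in> {0..1/2}"
  shows "param 2 (1, s) = param 0 (1, s)"
proof -
  define \<sigma> :: "nat \<Rightarrow> nat" where "\<sigma> = (\<lambda>e. if e = 0 then 2 else if e = 2 then 0 else e)"
  have "bij_betw \<sigma> {0, 1, 2} {0, 1, 2}"
    by (rule bij_betw_byWitness[where f' = \<sigma>]) (auto simp: \<sigma>_def)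
  then have r: "relabels id \<sigma> (\<lambda>_. False) theta (lens 1) theta (lens 1)"
    unfolding relabels_def by (auto simp: \<sigma>_def lens_def)
  have "isometric 1 (theta, lens 1, mark 2 s) (theta, lens 1, mark 0 s)"
  proof (rule isometric_if_relabels[OF r weighted_theta weighted_theta])
    show "mark 0 s i = relabel id \<sigma> (\<lambda>_. False) (mark 2 s i)" if "i \<in> {1..1}" for i
      using that relabel_glue[OF r, of 2 s] by (simp add: mark_def \<sigma>_def del: glue.simps)
  qed auto
  moreover have "(theta, lens 1, mark 2 s) \<in> marked_metric_graphs 2 1"
    using param_marked[of 2 1 s] assms unfolding contract_marked_mark[OF one_neq_zero]
    by (simp add: parameters_def)
  ultimately show ?thesis
    unfolding param_def prod.case contract_marked_mark[OF one_neq_zero] by (rule iso_class_eqI[rotated])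
qed

lemma param_eq_if_coord_eq:
  assumes j: "j \<in> {0, 2}" "(a, s) \<in> parameters" and k: "k \<in> {0, 2}" "(b, t) \<in> parameters"
    and eq: "coord j (a, s) = coord k (b, t)"
  shows "param j (a, s) = param k (b, t)"
proof -
  have ab: "b = a" using eq by (auto simp: coord_def split: if_splits)
  have mixed: "param 0 (a, x) = param 2 (a, y)"
    if "x = a * y" "a * y * (1 - a) = 0" "y \<in> {0..1/2}" for x y
  proof -
    have "a = 0 \<or> y = 0 \<or> a = 1" using that by auto
    then show ?thesis
      using that param_zero_length param_vertex param_equal_lengths by auto
  qed
  consider "j = 0" "k = 0" | "j = 2" "k = 2" | "j = 0" "k = 2" | "j = 2" "k = 0"
    using j(1) k(1) by blast
  then show ?thesis
  proof cases
    case 1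
    then show ?thesis using eq by (simp add: coord_def)
  next
    case 2
    then show ?thesis
      using eq ab param_zero_length by (cases "a = 0") (auto simp: coord_def)
  next
    case 3
    then show ?thesis
      using eq ab mixed[of s t] k by (auto simp: coord_def parameters_def)
  next
    case 4
    then show ?thesis
      using eq ab mixed[of t s] j by (auto simp: coord_def parameters_def)
  qed
qed

section \<open>Every point of the space is parametrized\<close>

lemma point_on_edge:
  assumes G: "connected_graph G" and E: "edges G \<noteq> {}" and x: "x \<in> points G"
  obtains e s where "e \<in> edges G" "s \<in> {0..1}" "x = glue G (Inr e, s)"
proof -
  have "\<exists>e\<in>edges G. \<exists>s\<in>{0..1}. x = glue G (Inr e, s)"
    using x unfolding points_iff
  proof
    assume "\<exists>v\<in>verts G. x = (Inl v, 0)"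
    then obtain v where v: "v \<in> verts G" "x = (Inl v, 0)" by blast
    have "\<exists>e\<in>edges G. tail G e = v \<or> head G e = v"
    proof (rule ccontr)
      assume none: "\<not> ?thesis"
      then have "verts G = {v}"
        using verts_eq_singleton_if_isolated[of G "edges G" v] G v(1) by (auto simp: connected_graph_def)
      then show False using E none ends_in_verts[OF G] by fastforce
    qed
    then obtain e where e: "e \<in> edges G" "tail G e = v \<or> head G e = v" by blast
    then have "x = glue G (Inr e, 0) \<or> x = glue G (Inr e, 1)" using v by auto
    then have "\<exists>s\<in>{0..1}. x = glue G (Inr e, s)"
      by (metis atLeastAtMost_iff order_refl zero_le_one)
    then show ?thesis using e(1) by blast
  qed
  then show thesis using that by blast
qed

text \<open>Two edges of length less than 1 would form a cycle, so at most one edge is short; it becomes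
  edge 2, and a marked edge of length 1 becomes edge 0.\<close>

lemma theta_class_in_params:
  assumes t: "(G, l, p) \<in> marked_metric_graphs 2 1" and theta: "theta_graph G"
    and max: "Max (l ` edges G) = 1" and forest: "is_forest G {e \<in> edges G. l e < 1}"
  obtains k q where "k \<in> {0, 2}" "q \<in> parameters" "iso_class 2 1 (G, l, p) = param k q"
proof -
  have conn: "connected_graph G" and l_pos: "\<And>e. e \<in> edges G \<Longrightarrow> 0 < l e" and p1: "p 1 \<in> points G"
    using t by (auto simp: marked_metric_graphs_def stable_graph_def PiE_iff)
  obtain u v where uv: "u \<noteq> v" "verts G = {u, v}" "card (edges G) = 3" "\<And>e. e \<in> edges G \<Longrightarrow> joins G e u v"
    using theta by (auto simp: theta_graph_def)
  have fin: "finite (edges G)" using conn by (simp add: connected_graph_def)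
  have l_le: "l e \<le> 1" if "e \<in> edges G" for e
    using that fin max by (metis Max_ge finite_imageI imageI)
  obtain e0 s0 where e0: "e0 \<in> edges G" "s0 \<in> {0..1}" "p 1 = glue G (Inr e0, s0)"
  proof (rule point_on_edge[OF conn _ p1])
    show "edges G \<noteq> {}" using uv(3) by auto
  qed
  have short_unique: "e = f" if "e \<in> edges G" "l e < 1" "f \<in> edges G" "l f < 1" for e f
    by (rule parallel_not_in_forest[OF forest]) (use that uv in auto)
  \<comment> \<open>The edge that goes to edge 2: the short one if there is any.\<close>
  obtain x where x: "x \<in> edges G" "\<And>e. e \<in> edges G \<Longrightarrow> e \<noteq> x \<Longrightarrow> l e = 1"
  proof (cases "\<exists>e\<in>edges G. l e < 1")
    case True
    then obtain x where "x \<in> edges G" "l x < 1" by blast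
    then show thesis using that[of x] short_unique l_le by (metis order_less_le)
  next
    case False
    then show thesis using that[of e0] e0(1) l_le by (metis order_less_le)
  qed
  have card2: "card (edges G - {x}) = 2" using uv(3) x(1) by simp
  obtain y z where yz: "edges G - {x} = {y, z}" "y \<noteq> z" "e0 = x \<or> e0 = y"
  proof -
    obtain y z where "edges G - {x} = {y, z}" "y \<noteq> z" using card2 by (auto simp: card_2_iff)
    moreover from this have "e0 = x \<or> e0 = y \<or> e0 = z" using e0(1) by blast
    ultimately show thesis using that[of y z] that[of z y] by (metis insert_commute)
  qed
  have E: "edges G = {x, y, z}" and ne: "y \<noteq> x" "z \<noteq> x" using yz(1) x(1) by auto
  define \<sigma> :: "nat \<Rightarrow> nat" where "\<sigma> = (\<lambda>e. if e = x then 2 else if e = y then 0 else 1)"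
  \<comment> \<open>The end of the marked edge that is nearest to the marking goes to vertex 0.\<close>
  define w where "w = (if s0 \<le> 1 / 2 then tail G e0 else head G e0)"
  define \<tau> :: "nat \<Rightarrow> nat" where "\<tau> = (\<lambda>v. if v = w then 0 else 1)"
  define flip where "flip = (\<lambda>e. tail G e \<noteq> w)"
  define s where "s = (if flip e0 then 1 - s0 else s0)"
  have w: "w \<in> {u, v}" using ends_in_verts[OF conn e0(1)] uv(2) by (auto simp: w_def)
  have s: "s \<in> {0..1/2}"
    using e0(2) uv(1) uv(4)[OF e0(1)] by (auto simp: s_def flip_def w_def joins_def)
  have "bij_betw \<tau> {u, v} {0, 1}" using w uv(1) by (auto simp: \<tau>_def bij_betw_def inj_on_def)
  moreover have "bij_betw \<sigma> {x, y, z} {0, 1, 2}"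
    using ne yz(2) by (auto simp: \<sigma>_def bij_betw_def inj_on_def)
  moreover have "lens (l x) (\<sigma> e) = l e" if "e \<in> edges G" for e
    using that x(2) ne yz(2) unfolding E by (auto simp: \<sigma>_def)
  moreover have "if flip e then \<tau> (head G e) = 0 \<and> \<tau> (tail G e) = 1 else \<tau> (tail G e) = 0 \<and> \<tau> (head G e) = 1"
    if "e \<in> edges G" for e
    using uv(4)[OF that] uv(1) w by (auto simp: flip_def \<tau>_def joins_def)
  ultimately have r: "relabels \<tau> \<sigma> flip G l theta (lens (l x))"
    unfolding relabels_def theta_simps uv(2) E[symmetric] by (auto split: if_splits)
  have lx: "l x \<in> {0..1}" "l x \<noteq> 0" using l_pos[OF x(1)] l_le[OF x(1)] by auto
  have k: "\<sigma> e0 \<in> {0, 2}" using yz(3) ne by (auto simp: \<sigma>_def)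
  have "isometric 1 (G, l, p) (theta, lens (l x), mark (\<sigma> e0) s)"
  proof (rule isometric_if_relabels[OF r weighted_marked[OF t] weighted_theta[OF lx(1)]])
    fix i :: nat assume "i \<in> {1..1}"
    then have i: "i = 1" by simp
    show "mark (\<sigma> e0) s i = relabel \<tau> \<sigma> flip (p i)"
      unfolding i e0(3) relabel_glue[OF r e0(1)] by (simp add: mark_def s_def del: glue.simps)
  qed
  then have "iso_class 2 1 (G, l, p) = param (\<sigma> e0) (l x, s)"
    unfolding param_def prod.case contract_marked_mark[OF lx(2)] by (rule iso_class_eqI[OF t])
  moreover have "(l x, s) \<in> parameters" using lx(1) s by (simp add: parameters_def)
  ultimately show thesis using that k by blast
qed

text \<open>Loops are cycles, so both have length 1, and the graph is the contraction of the theta graph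
  along edge 2.\<close>

lemma rose_class_in_params:
  assumes t: "(G, l, p) \<in> marked_metric_graphs 2 1" and rose: "rose_graph G"
    and max: "Max (l ` edges G) = 1" and forest: "is_forest G {e \<in> edges G. l e < 1}"
  obtains k q where "k \<in> {0, 2}" "q \<in> parameters" "iso_class 2 1 (G, l, p) = param k q"
proof -
  have conn: "connected_graph G" and p1: "p 1 \<in> points G"
    using t by (auto simp: marked_metric_graphs_def stable_graph_def)
  obtain u where u: "verts G = {u}" "card (edges G) = 2" "\<And>e. e \<in> edges G \<Longrightarrow> tail G e = u \<and> head G e = u"
    using rose by (auto simp: rose_graph_def)
  have fin: "finite (edges G)" using conn by (simp add: connected_graph_def)
  have l1: "l e = 1" if e: "e \<in> edges G" for e
  proof -
    have "l e \<le> 1" using e fin max by (metis Max_ge finite_imageI imageI)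
    moreover have "\<not> l e < 1"
      using loop_not_in_forest[OF forest, of e] e u by auto
    ultimately show ?thesis by simp
  qed
  obtain e0 s0 where e0: "e0 \<in> edges G" "s0 \<in> {0..1}" "p 1 = glue G (Inr e0, s0)"
  proof (rule point_on_edge[OF conn _ p1])
    show "edges G \<noteq> {}" using u(2) by auto
  qed
  have "card (edges G - {e0}) = 1" using u(2) e0(1) by simp
  then obtain f where "edges G - {e0} = {f}" by (auto simp: card_1_singleton_iff)
  then have E: "edges G = {e0, f}" "f \<noteq> e0" using e0(1) by auto
  define H m where "H = contract theta {2}" and "m = restrict (lens 0) (edges theta - {2})"
  have H: "rose_graph H"
    unfolding H_def by (rule contract_theta[OF connected_theta theta_graph_theta]) simp
  then obtain w where w: "verts H = {w}" "\<And>e. e \<in> edges H \<Longrightarrow> tail H e = w \<and> head H e = w"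
    by (auto simp: rose_graph_def)
  have EH: "edges H = {0, 1}" by (auto simp: H_def contract_def)
  define s where "s = min s0 (1 - s0)"
  define \<sigma> :: "nat \<Rightarrow> nat" where "\<sigma> = (\<lambda>e. if e = e0 then 0 else 1)"
  define flip :: "nat \<Rightarrow> bool" where "flip = (\<lambda>_. 1 / 2 < s0)"
  have s: "s \<in> {0..1/2}" "s = (if flip e0 then 1 - s0 else s0)"
    using e0(2) by (auto simp: s_def flip_def min_def)
  have "bij_betw \<sigma> {e0, f} {0, 1}" using E(2) by (auto simp: \<sigma>_def bij_betw_def)
  moreover have "m (\<sigma> e) = 1" for e by (simp add: \<sigma>_def m_def)
  ultimately have r: "relabels (\<lambda>_. w) \<sigma> flip G l H m"
    using u w l1 E(1) unfolding relabels_def EH w(1) u(1) E(1) by (auto simp: bij_betw_def \<sigma>_def EH)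
  have t0: "contract_marked 1 (theta, lens 0, mark 0 s) = (H, m, \<lambda>i\<in>{1..1}. contract_point theta {2} (mark 0 s i))"
    by (simp add: contract_marked_def Let_def zero_edges_lens H_def m_def)
  have "(0, s) \<in> parameters" using s by (simp add: parameters_def)
  then have "(H, m, \<lambda>i\<in>{1..1}. contract_point theta {2} (mark 0 s i)) \<in> marked_metric_graphs 2 1"
    using param_marked[of 0 0 s] unfolding t0 by blast
  note wH = weighted_marked[OF this]
  have "isometric 1 (G, l, p) (H, m, \<lambda>i\<in>{1..1}. contract_point theta {2} (mark 0 s i))"
  proof (rule isometric_if_relabels[OF r weighted_marked[OF t] wH])
    fix i :: nat assume "i \<in> {1..1}"
    then have i: "i = 1" by simp
    show "(\<lambda>i\<in>{1..1}. contract_point theta {2} (mark 0 s i)) i = relabel (\<lambda>_. w) \<sigma> flip (p i)"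
      unfolding i e0(3) relabel_glue[OF r e0(1)]
      by (simp add: mark_def s(2) contract_glue H_def[symmetric] \<sigma>_def del: glue.simps)
  qed
  then have "iso_class 2 1 (G, l, p) = param 0 (0, s)"
    unfolding param_def prod.case t0 by (rule iso_class_eqI[OF t])
  then show thesis using that \<open>(0, s) \<in> parameters\<close> by blast
qed

lemma topspace_X_space: "topspace (X_space 2 1) = (\<Union>k\<in>{0, 2}. param k ` parameters)"
proof
  show "(\<Union>k\<in>{0, 2}. param k ` parameters) \<subseteq> topspace (X_space 2 1)"
    using param_in_X_space by blast
  show "topspace (X_space 2 1) \<subseteq> (\<Union>k\<in>{0, 2}. param k ` parameters)"
  proof
    fix c assume "c \<in> topspace (X_space 2 1)"
    then obtain G l p where c: "c = iso_class 2 1 (G, l, p)" and t: "(G, l, p) \<in> marked_metric_graphs 2 1"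
      and X: "Max (l ` edges G) = 1" "is_forest G {e \<in> edges G. l e < 1}"
      unfolding X_space_def by auto
    have "theta_graph G \<or> rose_graph G"
      using t by (intro stable_genus_2_cases) (auto simp: marked_metric_graphs_def)
    then obtain k q where "k \<in> {0, 2}" "q \<in> parameters" "c = param k q"
      using theta_class_in_params[OF t _ X] rose_class_in_params[OF t _ X] unfolding c by metis
    then show "c \<in> (\<Union>k\<in>{0, 2}. param k ` parameters)" by blast
  qed
qed

section \<open>Contractibility\<close>

lemma param_eq_iff:
  assumes "j \<in> {0, 2}" "k \<in> {0, 2}" "q \<in> parameters" "r \<in> parameters"
  shows "param j q = param k r \<longleftrightarrow> coord j q = coord k r"
proof -
  obtain a s b t where q: "q = (a, s)" "r = (b, t)" by (metis surj_pair)
  show ?thesis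
    using coord_eq_if_class_spread_eq[of j a s k b t] param_eq_if_coord_eq[of j a s k b t] assms
    unfolding q by auto
qed

text \<open>Distinct points of the space have different coordinates, hence are told apart by a
  continuous real function.\<close>

lemma Hausdorff_X_space: "Hausdorff_space (X_space 2 1)"
  unfolding Hausdorff_space_def
proof (intro allI impI, elim conjE)
  fix c d assume c: "c \<in> topspace (X_space 2 1)" and d: "d \<in> topspace (X_space 2 1)" and ne: "c \<noteq> d"
  obtain j a s where j: "j \<in> {0, 2}" "(a, s) \<in> parameters" "c = param j (a, s)"
    using c unfolding topspace_X_space by auto
  obtain k b t where k: "k \<in> {0, 2}" "(b, t) \<in> parameters" "d = param k (b, t)"
    using d unfolding topspace_X_space by auto
  have "\<not> (\<forall>ps. class_spread ps 1 c = class_spread ps 1 d)"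
  proof
    assume "\<forall>ps. class_spread ps 1 c = class_spread ps 1 d"
    then have "coord j (a, s) = coord k (b, t)"
      using j k by (intro coord_eq_if_class_spread_eq) auto
    then show False using ne param_eq_if_coord_eq[OF j(1,2) k(1,2)] j k by simp
  qed
  then obtain ps where ps: "class_spread ps 1 c \<noteq> class_spread ps 1 d" by blast
  have cont: "continuous_map (X_space 2 1) euclideanreal (class_spread ps 1)"
    unfolding X_space_def
    by (intro continuous_map_from_subtopology class_spread_continuous contract_marked_in_marked_metric_graphs)
      auto
  obtain U V where UV: "open U" "open V" "class_spread ps 1 c \<in> U" "class_spread ps 1 d \<in> V" "U \<inter> V = {}"
    using hausdorff[OF ps] by blast
  show "\<exists>U V. openin (X_space 2 1) U \<and> openin (X_space 2 1) V \<and> c \<in> U \<and> d \<in> V \<and> disjnt U V"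
  proof (intro exI conjI)
    show "openin (X_space 2 1) {x \<in> topspace (X_space 2 1). class_spread ps 1 x \<in> U}"
      "openin (X_space 2 1) {x \<in> topspace (X_space 2 1). class_spread ps 1 x \<in> V}"
      using openin_continuous_map_preimage[OF cont] UV(1,2) by auto
  qed (use c d UV in \<open>auto simp: disjnt_def\<close>)
qed

lemma homeomorphic_model:
  "top_of_set (\<Union>k\<in>{0, 2}. coord k ` parameters) homeomorphic_space X_space 2 1"
proof (rule homeomorphic_if_same_fibres[OF compact_parameters _ continuous_on_coord _ topspace_X_space
      Hausdorff_X_space param_eq_iff])
  show "continuous_map (top_of_set parameters) (X_space 2 1) (param k)" if "k \<in> {0, 2}" for k
    unfolding X_space_def
  proof (rule continuous_map_into_subtopology[OF continuous_map_param[OF that]])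
    show "param k \<in> topspace (top_of_set parameters) \<rightarrow> {iso_class 2 1 (G, l, p) | G l p.
          (G, l, p) \<in> marked_metric_graphs 2 1 \<and> Max (l ` edges G) = 1 \<and>
          is_forest G {e \<in> edges G. l e < 1}}"
      using param_in_X_space[OF that] unfolding X_space_def topspace_subtopology by auto
  qed
qed auto

theorem mainTheorem11:
  shows "topspace (X_space 2 1) \<noteq> {} \<and> contractible_space (X_space 2 1)"
proof
  have "(1, 0) \<in> parameters" by (simp add: parameters_def)
  then show "topspace (X_space 2 1) \<noteq> {}" using param_in_X_space[of 0 "(1, 0)"] by auto
  have "contractible_space (top_of_set (\<Union>k\<in>{0, 2}. coord k ` parameters))"
    using contractible_model by simp
  then show "contractible_space (X_space 2 1)"
    using homeomorphic_space_contractibility[OF homeomorphic_model] by blast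
qed

end
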